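(* Let $0<q<1$. Consider a rational curve with double points, obtained by identifying $2g$ distinct points of $\mathbb P^1(\mathbb C)\setminus\{0,\infty\}$ in pairs $\{\lambda_i,\mu_i\}$, $i=1,\dots,g$. Assume that $$\lambda_i=q^{k_i}\mu_i,\qquad k_i\in\mathbb N\setminus\{0\}.$$ Then the reduced wave function $\Psi(n,z)$, besides being a common eigenfunction of a rank 1 commutative ring of difference operators in $n$ isomorphic to $A_{\mathcal V}$, $$L_f\Psi(n,z)=f(z)\Psi(n,z),\qquad\forall f\in A_{\mathcal V},$$ is also a common eigenfunction of a rank 1 commutative ring of $q$-difference operators in the variable $z$, isomorphic to $A_{\tilde{\mathcal V}}$ for some rational flag $\tilde{\mathcal V}$: for every $g\in A_{\tilde{\mathcal V}}$ there is a $q$-difference operator $B_g$ in $z$ (coefficients independent of $n$) with $$B_g\Psi(n,z)=g(q^n)\Psi(n,z).$$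
   Context: Difference operators in $n\in\mathbb Z$ are finite sums $\sum_jh_j(n)E^j$, $Eh(n)=h(n+1)$; $q$-difference operators in $z$ are finite sums $\sum_jD_j(z)D_z^j$, $D_zh(z)=h(qz)$. The rank of a commutative ring of such operators is the greatest common divisor of the orders (highest power of the shift occurring) of its elements. Let $\mathcal P=\mathbb C[z]$, $\mathcal R=\mathbb C(z)$. A rational flag is a flag $\mathcal V:\cdots\subset V_{n+1}\subset V_n\subset V_{n-1}\subset\cdots$ of subspaces of $\mathcal R$ for which there are polynomials $p(z),r(z)$ independent of $n$ with $z^np(z)\mathcal P\subset V_n\subset z^nr(z)^{-1}\mathcal P$ and $\mathrm{codim}$ of $V_n$ in $z^nr(z)^{-1}\mathcal P$ equal to $\deg r$. To it is associated the ring $$A_{\mathcal V}=\{f\in\mathcal R\text{ with poles only at }0\text{ and }\infty:\ \exists k\in\mathbb Z,\ f(z)V_n\subset V_{n+k}\ \forall n\}.$$ Here $\mathcal V$ is the flag, depending on arbitrary $\delta_i\in\mathbb C\setminus\{0\}$, $$V_n=\frac1{\prod_{i=1}^g(z-\lambda_i)}\big\{f\in z^n\mathcal P:\ f(\lambda_i)=\delta_if(\mu_i),\ i=1,\dots,g\big\},$$ and the reduced wave function is $$\Psi(n,z)=\frac{1}{\prod_{j=1}^g(z-\lambda_j)}\,\frac{\det\big(\lambda_j^{n+i-1}-\delta_j\mu_j^{n+i-1};\ z^{n+i-1}\big)}{\det\big(\lambda_j^{n+i-1}-\delta_j\mu_j^{n+i-1}\big)_{1\le i,j\le g}},$$ where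 the numerator is the determinant of the $(g+1)\times(g+1)$ matrix with the indicated $(i,j)$ entries for $1\le i\le g+1$, $1\le j\le g$, and last column $z^{n+i-1}$, $1\le i\le g+1$. The $\delta_j$ are assumed such that the denominator is nonzero for all $n\in\mathbb Z$. *)

theory Defs
  imports
    "HOL-Computational_Algebra.Computational_Algebra"
    "HOL-Computational_Algebra.Field_as_Ring"
    "HOL-Library.Function_Algebras"
    "HOL-Algebra.QuotRing"
    "Jordan_Normal_Form.Determinant"
begin

section \<open>The field of rational functions over the complex numbers\<close>

type_synonym ratfun = "complex poly fract"

definition const :: "complex \<Rightarrow> ratfun" where
  "const c = to_fract [:c:]"

definition Z :: ratfun where
  "Z = to_fract [:0, 1:]"

text \<open>\<^const>\<open>quot_of_fract\<close> yields numerator and denominator in lowest terms.\<close>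

definition pole_at :: "ratfun \<Rightarrow> complex \<Rightarrow> bool" where
  "pole_at f a \<longleftrightarrow> poly (snd (quot_of_fract f)) a = 0"

text \<open>The value at \<open>a\<close>; meaningful only when \<open>a\<close> is not a pole of \<open>f\<close>.\<close>

definition rf_eval :: "ratfun \<Rightarrow> complex \<Rightarrow> complex" where
  "rf_eval f a = poly (fst (quot_of_fract f)) a / poly (snd (quot_of_fract f)) a"

text \<open>The substitution \<open>h(z) \<mapsto> h(c z)\<close>, used only for \<open>c \<noteq> 0\<close>.\<close>

definition dilate :: "complex \<Rightarrow> ratfun \<Rightarrow> ratfun" where
  "dilate c h = Fract (pcompose (fst (quot_of_fract h)) [:0, c:])
                      (pcompose (snd (quot_of_fract h)) [:0, c:])"

lemma const_add: "const (a + b) = const a + const b"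
  by (simp add: const_def to_fract_def)

lemma const_mult: "const (a * b) = const a * const b"
  by (simp add: const_def to_fract_def mult.commute)

lemma const_1: "const 1 = 1"
  by (simp add: const_def to_fract_def One_fract_def one_pCons)

global_interpretation cvs: vector_space "\<lambda>(c::complex) (f::ratfun). const c * f"
  by unfold_locales (simp_all add: const_add const_mult const_1 algebra_simps)

text \<open>The next two lemmas express that evaluation and substitution may be computed from any
  representation as a fraction, not only from the one in lowest terms.\<close>

lemma rf_eval_Fract:
  assumes "poly s a \<noteq> 0"
  shows "\<not> pole_at (Fract p s) a" "rf_eval (Fract p s) a = poly p a / poly s a"
proof -
  define u where "u = fst (quot_of_fract (Fract p s))"
  define v where "v = snd (quot_of_fract (Fract p s))"
  have s0: "s \<noteq> 0" using assms by auto
  have v0: "v \<noteq> 0" unfolding v_def by simp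
  have "Fract u v = Fract p s" unfolding u_def v_def by simp
  hence eq: "u * s = p * v" using s0 v0 by (simp add: eq_fract)
  have cop: "coprime u v"
    unfolding u_def v_def by (rule coprime_quot_of_fract)
  have "v dvd u * s" using eq by simp
  hence "v dvd s" using cop by (simp add: coprime_dvd_mult_right_iff coprime_commute)
  hence va: "poly v a \<noteq> 0" using assms by (auto elim!: dvdE)
  thus "\<not> pole_at (Fract p s) a" by (simp add: pole_at_def v_def)
  have "poly u a * poly s a = poly p a * poly v a" using arg_cong[OF eq, of "\<lambda>t. poly t a"] by simp
  thus "rf_eval (Fract p s) a = poly p a / poly s a"
    using va assms by (simp add: rf_eval_def u_def v_def field_simps)
qed

lemma dilate_Fract:
  assumes "c \<noteq> 0" "s \<noteq> 0"
  shows "dilate c (Fract p s) = Fract (pcompose p [:0, c:]) (pcompose s [:0, c:])"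
proof -
  define u where "u = fst (quot_of_fract (Fract p s))"
  define v where "v = snd (quot_of_fract (Fract p s))"
  have v0: "v \<noteq> 0" unfolding v_def by simp
  have nz: "pcompose t [:0, c:] \<noteq> 0" if "t \<noteq> 0" for t
    using that assms(1) pcompose_eq_0[of t "[:0, c:]"] by auto
  have "Fract u v = Fract p s" unfolding u_def v_def by simp
  hence "u * s = p * v" using assms v0 by (simp add: eq_fract)
  hence "pcompose (u * s) [:0, c:] = pcompose (p * v) [:0, c:]"
    by (rule arg_cong)
  hence "pcompose u [:0, c:] * pcompose s [:0, c:] = pcompose p [:0, c:] * pcompose v [:0, c:]"
    by (simp only: pcompose_mult)
  thus ?thesis
    unfolding dilate_def u_def[symmetric] v_def[symmetric]
    using nz[OF v0] nz[OF assms(2)] by (simp add: eq_fract)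
qed

section \<open>Rational flags\<close>

text \<open>The subspace \<open>z\<^sup>n a(z) \<P>\<close>, where \<open>\<P>\<close> is the space of polynomials.\<close>

definition zpoly_space :: "int \<Rightarrow> ratfun \<Rightarrow> ratfun set" where
  "zpoly_space n a = range (\<lambda>p. Z powi n * a * to_fract p)"

text \<open>\<open>V\<close> has codimension \<open>d\<close> in \<open>W\<close>: a complement of \<open>V\<close> in \<open>W\<close> has a basis of
  \<open>d\<close> elements.\<close>

definition has_codim :: "ratfun set \<Rightarrow> ratfun set \<Rightarrow> nat \<Rightarrow> bool" where
  "has_codim V W d \<longleftrightarrow> V \<subseteq> W \<and>
     (\<exists>B. finite B \<and> card B = d \<and> cvs.independent B \<and> cvs.span B \<inter> V = {0} \<and>
          {u + v |u v. u \<in> cvs.span B \<and> v \<in> V} = W)"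

text \<open>The codimension condition forces each \<open>V (n + 1)\<close> to have codimension 1 in \<open>V n\<close>, so
  the inclusions of a flag are automatically strict.\<close>

definition rational_flag :: "(int \<Rightarrow> ratfun set) \<Rightarrow> bool" where
  "rational_flag V \<longleftrightarrow>
     (\<forall>n. cvs.subspace (V n)) \<and> (\<forall>n. V (n + 1) \<subseteq> V n) \<and>
     (\<exists>p r. p \<noteq> 0 \<and> r \<noteq> 0 \<and>
        (\<forall>n. zpoly_space n (to_fract p) \<subseteq> V n \<and>
             V n \<subseteq> zpoly_space n (inverse (to_fract r)) \<and>
             has_codim (V n) (zpoly_space n (inverse (to_fract r))) (degree r)))"

definition flag_ring :: "(int \<Rightarrow> ratfun set) \<Rightarrow> ratfun set" where
  "flag_ring V = {f. (\<forall>a. a \<noteq> 0 \<longrightarrow> \<not> pole_at f a) \<and>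
                     (\<exists>k. \<forall>n. (\<lambda>v. f * v) ` V n \<subseteq> V (n + k))}"

section \<open>Difference and q-difference operators\<close>

text \<open>Operators are identified with the maps they induce, on functions from the integers to
  rational functions and on rational functions respectively; composition is the product.  The
  coefficients are determined by the map (for the second kind because \<open>q\<close> is not a root of
  unity).  Negative powers of the shifts are allowed.\<close>

definition diff_op :: "(int \<Rightarrow> int \<Rightarrow> complex) \<Rightarrow> (int \<Rightarrow> ratfun) \<Rightarrow> (int \<Rightarrow> ratfun)" where
  "diff_op h = (\<lambda>\<phi> n. \<Sum>j | h j \<noteq> 0. const (h j n) * \<phi> (n + j))"

definition qdiff_op :: "real \<Rightarrow> (int \<Rightarrow> ratfun) \<Rightarrow> ratfun \<Rightarrow> ratfun" where
  "qdiff_op q D = (\<lambda>\<phi>. \<Sum>j | D j \<noteq> 0. D j * dilate (complex_of_real q powi j) \<phi>)"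

definition diff_ops :: "((int \<Rightarrow> ratfun) \<Rightarrow> (int \<Rightarrow> ratfun)) set" where
  "diff_ops = {diff_op h |h. finite {j. h j \<noteq> 0}}"

definition qdiff_ops :: "real \<Rightarrow> (ratfun \<Rightarrow> ratfun) set" where
  "qdiff_ops q = {qdiff_op q D |D. finite {j. D j \<noteq> 0}}"

text \<open>The zero operator has no order.\<close>

definition diff_has_order :: "((int \<Rightarrow> ratfun) \<Rightarrow> (int \<Rightarrow> ratfun)) \<Rightarrow> int \<Rightarrow> bool" where
  "diff_has_order L d \<longleftrightarrow>
     (\<exists>h. finite {j. h j \<noteq> 0} \<and> L = diff_op h \<and> h d \<noteq> 0 \<and> (\<forall>j>d. h j = 0))"

definition qdiff_has_order :: "real \<Rightarrow> (ratfun \<Rightarrow> ratfun) \<Rightarrow> int \<Rightarrow> bool" where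
  "qdiff_has_order q B d \<longleftrightarrow>
     (\<exists>D. finite {j. D j \<noteq> 0} \<and> B = qdiff_op q D \<and> D d \<noteq> 0 \<and> (\<forall>j>d. D j = 0))"

definition diff_rank :: "((int \<Rightarrow> ratfun) \<Rightarrow> (int \<Rightarrow> ratfun)) set \<Rightarrow> int" where
  "diff_rank S = Gcd {d. \<exists>L\<in>S. diff_has_order L d}"

definition qdiff_rank :: "real \<Rightarrow> (ratfun \<Rightarrow> ratfun) set \<Rightarrow> int" where
  "qdiff_rank q S = Gcd {d. \<exists>B\<in>S. qdiff_has_order q B d}"

definition func_ring :: "ratfun set \<Rightarrow> ratfun ring" where
  "func_ring A = \<lparr>carrier = A, monoid.mult = (*), one = 1, ring.zero = 0, add = (+)\<rparr>"

definition op_ring :: "('a::ab_group_add \<Rightarrow> 'a) set \<Rightarrow> ('a \<Rightarrow> 'a) ring" where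
  "op_ring S = \<lparr>carrier = S, monoid.mult = (\<circ>), one = id, ring.zero = (\<lambda>x. 0),
                add = (\<lambda>P Q x. P x + Q x)\<rparr>"

section \<open>The flag and the reduced wave function of a curve with double points\<close>

text \<open>The indices \<open>1, \<dots>, g\<close> are shifted to \<open>0, \<dots>, g - 1\<close>; likewise rows and columns of the
  matrices are numbered from 0.\<close>

definition curve_flag ::
  "nat \<Rightarrow> (nat \<Rightarrow> complex) \<Rightarrow> (nat \<Rightarrow> complex) \<Rightarrow> (nat \<Rightarrow> complex) \<Rightarrow> int \<Rightarrow> ratfun set" where
  "curve_flag g lam mu \<delta> n =
     (\<lambda>f. inverse (\<Prod>i<g. Z - const (lam i)) * f) `
       {f \<in> zpoly_space n 1. \<forall>i<g. rf_eval f (lam i) = \<delta> i * rf_eval f (mu i)}"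

definition wave_den ::
  "nat \<Rightarrow> (nat \<Rightarrow> complex) \<Rightarrow> (nat \<Rightarrow> complex) \<Rightarrow> (nat \<Rightarrow> complex) \<Rightarrow> int \<Rightarrow> complex" where
  "wave_den g lam mu \<delta> n =
     det (mat g g (\<lambda>(i, j). lam j powi (n + int i) - \<delta> j * mu j powi (n + int i)))"

definition wave_num ::
  "nat \<Rightarrow> (nat \<Rightarrow> complex) \<Rightarrow> (nat \<Rightarrow> complex) \<Rightarrow> (nat \<Rightarrow> complex) \<Rightarrow> int \<Rightarrow> ratfun" where
  "wave_num g lam mu \<delta> n =
     det (mat (g + 1) (g + 1) (\<lambda>(i, j).
       if j < g then const (lam j powi (n + int i) - \<delta> j * mu j powi (n + int i))
       else Z powi (n + int i)))"

definition wave ::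
  "nat \<Rightarrow> (nat \<Rightarrow> complex) \<Rightarrow> (nat \<Rightarrow> complex) \<Rightarrow> (nat \<Rightarrow> complex) \<Rightarrow> int \<Rightarrow> ratfun" where
  "wave g lam mu \<delta> n =
     inverse (\<Prod>j<g. Z - const (lam j)) *
       (wave_num g lam mu \<delta> n / const (wave_den g lam mu \<delta> n))"

end

(* Write Psi_n = z^n p_n(z) / prod (z - lambda_i), with p_n monic of degree g, and x = q^n.

   Difference operators.  The gluing conditions have no nonzero solution of degree < g, so by
   removing leading terms every element of V_m of bounded degree is a unique combination of
   Psi_m, Psi_{m+1}, ...; applied to f Psi_n this gives L_f.

   q-difference operators.  Let D be the dilation by q, so that a(D) z^n = a(x) z^n.  As
   lambda_i = q^{k_i} mu_i, the gluing conditions read x^{k_i} p_n(lambda_i) = delta_i p_n(mu_i),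
   with coefficients polynomial in x.  Cramer's rule gives an operator S with
   S z^n = tau(x) Psi_n.  Conversely, the partial fractions of z^j Psi_n / prod (z - mu_i),
   j = 0, ..., g, involve z^n/(z - lambda_i) and z^n/(z - mu_i); the gluing conditions and
   D^{k_i} reduce these to the g functions z^n/(z - lambda_i), which can be eliminated.  This
   gives R with R Psi_n = theta(x) z^n.  For a Laurent polynomial l the operator S l(D) R has the
   eigenvalue tau(x) l(x) theta(x), so all Laurent polynomials that are constant modulo a suitable
   multiple s of tau theta are eigenvalues; they form the ring of a rational flag.  P is determined
   by its action on all Psi_n, since P S vanishes if P annihilates them. *)

theory Submission
  imports Defs
begin

text \<open>The positivity of the k_i acts through the point x = 0. There every term with a factor
  x^{k_i} drops out, and tau and theta become scaled Vandermonde determinants in the mu_i and the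
  lambda_i. So both are nonzero at 0; this shows that S and R are nonzero operators, and it allows
  the normalization s(0) = 1. Then x is invertible modulo s, which makes the codimension of the flag
  the same at every level. The extra factor x - 1 of s provides a point where the constant of an
  element can be read off.

  The eigenvalues tau l theta only form an ideal; the constants are adjoined to obtain a ring with
  unit. Since q is not a root of unity, the points q^n are infinitely many, and a Laurent polynomial
  is known from its values there.

  For the rank it is enough to find one operator of order 1. Both rings of functions contain z^e
  times a fixed element for every integer e, and the order of the corresponding operator moves with
  e. On the q-difference side this replaces a computation of the orders of S and R, which are only
  known to exist.\<close>

section \<open>Rational functions\<close>

lemma const_0 [simp]: "const 0 = 0"
  by (simp add: const_def)

lemma const_minus: "const (- a) = - const a"
  by (simp add: const_def flip: to_fract_uminus)

lemma const_eq_iff [simp]: "const a = const b \<longleftrightarrow> a = b"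
  by (simp add: const_def)

lemma const_eq_0_iff [simp]: "const a = 0 \<longleftrightarrow> a = 0"
  by (simp add: const_def)

lemma const_power: "const (a ^ n) = const a ^ n"
  by (induction n) (simp_all add: const_1 const_mult)

lemma const_inverse: "const (inverse a) = inverse (const a)"
proof (cases "a = 0")
  case False
  then have "const a * const (inverse a) = 1"
    by (simp flip: const_mult add: const_1)
  then show ?thesis
    by (simp add: inverse_unique)
qed simp

lemma const_divide: "const (a / b) = const a / const b"
  by (simp add: divide_inverse const_mult const_inverse)

lemma const_powi: "const (a powi n) = const a powi n"
  by (cases n rule: int_cases3)
    (simp_all add: const_1 power_int_minus const_inverse const_power)

lemma Z_neq_0 [simp]: "Z \<noteq> 0"
  by (simp add: Z_def)

lemma Z_minus_const: "Z - const a = to_fract [:- a, 1:]"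
  by (simp add: Z_def const_def flip: to_fract_diff)

lemma Z_minus_const_neq_0 [simp]: "Z - const a \<noteq> 0"
  by (simp add: Z_minus_const)

lemma Z_neq_const [simp]: "Z \<noteq> const a" "const a \<noteq> Z"
  using Z_minus_const_neq_0[of a] by auto

lemma to_fract_prod: "to_fract (prod f A) = (\<Prod>x\<in>A. to_fract (f x))"
  by (induction A rule: infinite_finite_induct) simp_all

lemma to_fract_power: "to_fract (p ^ n) = to_fract p ^ n"
  by (induction n) simp_all

lemma to_fract_smult: "to_fract (Polynomial.smult c p) = const c * to_fract p"
  by (simp add: const_def flip: to_fract_mult)

lemma to_fract_pCons: "to_fract (pCons c p) = const c + Z * to_fract p"
  by (simp add: const_def Z_def flip: to_fract_mult to_fract_add)

lemma to_fract_monom: "to_fract (Polynomial.monom c n) = const c * Z ^ n"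
  by (induction n) (simp_all add: monom_Suc to_fract_pCons monom_0)

lemma to_fract_conv_sum:
  assumes "degree p \<le> n"
  shows "to_fract p = (\<Sum>i\<le>n. const (poly.coeff p i) * Z ^ i)"
proof -
  have "p = (\<Sum>i\<le>n. Polynomial.monom (poly.coeff p i) i)"
    by (rule poly_as_sum_of_monoms'[symmetric]) (fact assms)
  then show ?thesis
    by (metis (mono_tags, lifting) sum.cong to_fract_monom to_fract_sum)
qed

lemma fract_to_fract_cases:
  obtains p s where "f = to_fract p / to_fract s" "s \<noteq> (0 :: complex poly)"
  by (metis Fract_conv_to_fract Fract_quot_of_fract snd_quot_of_fract_nonzero)

text \<open>Once the power of z is split off from the reduced denominator, what remains has no root
  in the complex numbers and hence is constant.\<close>

lemma laurent_iff:
  "(\<forall>a. a \<noteq> 0 \<longrightarrow> \<not> pole_at f a) \<longleftrightarrow> (\<exists>e p. f = Z powi e * to_fract p)"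
proof
  assume *: "\<forall>a. a \<noteq> 0 \<longrightarrow> \<not> pole_at f a"
  define s where "s = snd (quot_of_fract f)"
  define p where "p = fst (quot_of_fract f)"
  have s: "s \<noteq> 0" by (simp add: s_def)
  obtain t m where t: "s = [:- 0, 1:] ^ m * t" "\<not> [:- 0, 1:] dvd t"
    using order_decomp[OF s, of 0] by blast
  have "poly t a \<noteq> 0" for a
  proof (cases "a = 0")
    case False
    then show ?thesis
      using * t(1) by (auto simp: pole_at_def s_def[symmetric])
  next
    case True
    then show ?thesis using t(2) by (simp add: poly_eq_0_iff_dvd)
  qed
  then have "degree t = 0"
    by (metis constant_degree fundamental_theorem_of_algebra)
  then obtain c where c: "t = [:c:]"
    by (metis degree_eq_zeroE)
  have "c \<noteq> 0" using t(2) c by auto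
  have sZ: "to_fract s = Z ^ m * const c"
    by (subst t(1)) (simp add: to_fract_power c Z_def const_def del: mult_pCons_right)
  have "f = to_fract p / to_fract s"
    by (metis Fract_conv_to_fract Fract_quot_of_fract p_def s_def)
  also have "\<dots> = Z powi (- int (m)) * to_fract (Polynomial.smult (inverse c) p)"
    by (simp add: sZ to_fract_smult power_int_minus const_divide const_1 field_simps)
  finally show "\<exists>e p. f = Z powi e * to_fract p" by blast
next
  assume "\<exists>e p. f = Z powi e * to_fract p"
  then obtain e p where f: "f = Z powi e * to_fract p" by blast
  show "\<forall>a. a \<noteq> 0 \<longrightarrow> \<not> pole_at f a"
  proof (intro allI impI)
    fix a :: complex assume a: "a \<noteq> 0"
    have "\<exists>u. f = Fract u ([:0, 1:] ^ nat (- e))"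
    proof (cases "e \<ge> 0")
      case True
      then show ?thesis
        by (intro exI[of _ "[:0, 1:] ^ nat e * p"])
          (simp add: f Fract_conv_to_fract to_fract_power Z_def power_int_def)
    next
      case False
      then show ?thesis
        by (intro exI[of _ p])
          (simp add: f Fract_conv_to_fract to_fract_power Z_def power_int_def field_simps)
    qed
    then show "\<not> pole_at f a" using rf_eval_Fract(1) a by force
  qed
qed

lemma rf_eval_laurent:
  assumes "a \<noteq> 0"
  shows "rf_eval (Z powi e * to_fract p) a = a powi e * poly p a"
proof (cases "e \<ge> 0")
  case True
  then have "Z powi e * to_fract p = Fract ([:0, 1:] ^ nat e * p) 1"
    by (simp add: Fract_conv_to_fract to_fract_power Z_def power_int_def)
  then show ?thesis using True
    by (simp add: rf_eval_Fract power_int_def)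
next
  case False
  then have "Z powi e * to_fract p = Fract p ([:0, 1:] ^ nat (- e))"
    by (simp add: Fract_conv_to_fract to_fract_power Z_def power_int_def field_simps)
  then show ?thesis using False assms
    by (simp add: rf_eval_Fract power_int_def field_simps)
qed

lemma laurent_add:
  "\<exists>e' p'. Z powi e1 * to_fract p1 + Z powi e2 * to_fract p2 = Z powi e' * to_fract p'"
proof -
  have *: "\<exists>p'. Z powi e1 * to_fract p1 + Z powi e2 * to_fract p2 = Z powi e1 * to_fract p'"
    if "e1 \<le> e2" for e1 e2 p1 p2
  proof -
    have "Z powi e2 = Z powi e1 * Z ^ nat (e2 - e1)"
      using that by (subst power_int_of_nat[symmetric], subst power_int_add[symmetric]) auto
    then show ?thesis
      by (intro exI[of _ "p1 + [:0, 1:] ^ nat (e2 - e1) * p2"])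
        (simp add: to_fract_power Z_def algebra_simps)
  qed
  show ?thesis
    using *[of e1 e2 p1 p2] *[of e2 e1 p2 p1] by (metis add.commute linorder_le_cases)
qed

lemma dilate_divide_to_fract:
  assumes "c \<noteq> 0" "s \<noteq> 0"
  shows "dilate c (to_fract p / to_fract s) =
    to_fract (p \<circ>\<^sub>p [:0, c:]) / to_fract (s \<circ>\<^sub>p [:0, c:])"
  using dilate_Fract[OF assms] by (simp add: Fract_conv_to_fract)

lemma pcompose_scale_eq_0_iff:
  assumes "c \<noteq> 0"
  shows "p \<circ>\<^sub>p [:0, c:] = 0 \<longleftrightarrow> p = (0 :: complex poly)"
  using assms pcompose_eq_0[of p "[:0, c:]"] by auto

lemma dilate_to_fract: "c \<noteq> 0 \<Longrightarrow> dilate c (to_fract p) = to_fract (p \<circ>\<^sub>p [:0, c:])"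
  using dilate_divide_to_fract[of c 1 p] by (simp add: pcompose_1)

lemma dilate_add:
  assumes c: "c \<noteq> 0"
  shows "dilate c (f + g) = dilate c f + dilate c g"
proof -
  obtain p s where f: "f = to_fract p / to_fract s" "s \<noteq> 0" by (rule fract_to_fract_cases)
  obtain u v where g: "g = to_fract u / to_fract v" "v \<noteq> 0" by (rule fract_to_fract_cases)
  have fg: "f + g = to_fract (p * v + u * s) / to_fract (s * v)"
    unfolding f(1) g(1) using f(2) g(2) by (simp add: divide_simps)
  have "dilate c (f + g) =
      to_fract ((p * v + u * s) \<circ>\<^sub>p [:0, c:]) / to_fract ((s * v) \<circ>\<^sub>p [:0, c:])"
    unfolding fg using f(2) g(2) c by (subst dilate_divide_to_fract) auto
  also have "\<dots> = dilate c f + dilate c g"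
    unfolding f(1) g(1) using f(2) g(2) c
    by (simp add: dilate_divide_to_fract pcompose_scale_eq_0_iff pcompose_add pcompose_mult divide_simps)
  finally show ?thesis .
qed

lemma dilate_mult:
  assumes c: "c \<noteq> 0"
  shows "dilate c (f * g) = dilate c f * dilate c g"
proof -
  obtain p s where f: "f = to_fract p / to_fract s" "s \<noteq> 0" by (rule fract_to_fract_cases)
  obtain u v where g: "g = to_fract u / to_fract v" "v \<noteq> 0" by (rule fract_to_fract_cases)
  have "f * g = to_fract (p * u) / to_fract (s * v)"
    using f g by simp
  then show ?thesis
    using f g c
    by (simp add: dilate_divide_to_fract pcompose_mult del: to_fract_mult) simp
qed

lemma dilate_const [simp]: "c \<noteq> 0 \<Longrightarrow> dilate c (const a) = const a"
  by (simp add: const_def dilate_to_fract)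

lemma dilate_0 [simp]: "c \<noteq> 0 \<Longrightarrow> dilate c 0 = 0"
  using dilate_const[of c 0] by simp

lemma dilate_1 [simp]: "c \<noteq> 0 \<Longrightarrow> dilate c 1 = 1"
  using dilate_const[of c 1] by (simp add: const_1)

lemma dilate_Z: "c \<noteq> 0 \<Longrightarrow> dilate c Z = const c * Z"
  by (simp add: Z_def dilate_to_fract const_def pcompose_pCons flip: to_fract_mult)

lemma dilate_minus:
  assumes "c \<noteq> 0"
  shows "dilate c (- f) = - dilate c f"
  using dilate_add[OF assms, of f "- f"] assms by (simp add: eq_neg_iff_add_eq_0 add.commute)

lemma dilate_diff: "c \<noteq> 0 \<Longrightarrow> dilate c (f - g) = dilate c f - dilate c g"
  using dilate_add[of c f "- g"] by (simp add: dilate_minus)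

lemma dilate_eq_0_iff:
  assumes c: "c \<noteq> 0"
  shows "dilate c f = 0 \<longleftrightarrow> f = 0"
proof
  assume *: "dilate c f = 0"
  show "f = 0"
  proof (rule ccontr)
    assume "f \<noteq> 0"
    then have "dilate c f * dilate c (inverse f) = 1"
      using c by (simp flip: dilate_mult)
    with * show False by simp
  qed
qed (use c in simp)

lemma dilate_inverse:
  assumes c: "c \<noteq> 0"
  shows "dilate c (inverse f) = inverse (dilate c f)"
proof (cases "f = 0")
  case False
  then have "dilate c f * dilate c (inverse f) = 1"
    using c by (simp flip: dilate_mult)
  then show ?thesis by (simp add: inverse_unique)
qed (use c in simp)

lemma dilate_power: "c \<noteq> 0 \<Longrightarrow> dilate c (f ^ n) = dilate c f ^ n"
  by (induction n) (simp_all add: dilate_mult)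

lemma dilate_powi: "c \<noteq> 0 \<Longrightarrow> dilate c (f powi n) = dilate c f powi n"
  by (cases n rule: int_cases3) (simp_all add: dilate_power dilate_inverse power_int_minus)

lemma dilate_dilate:
  assumes "a \<noteq> 0" "b \<noteq> 0"
  shows "dilate a (dilate b f) = dilate (a * b) f"
proof -
  obtain p s where f: "f = to_fract p / to_fract s" "s \<noteq> 0" by (rule fract_to_fract_cases)
  have "(p \<circ>\<^sub>p [:0, b:]) \<circ>\<^sub>p [:0, a:] = p \<circ>\<^sub>p [:0, a * b:]" for p :: "complex poly"
    by (simp add: pcompose_assoc[symmetric] pcompose_pCons mult.commute)
  then show ?thesis
    using f assms by (simp add: dilate_divide_to_fract pcompose_scale_eq_0_iff)
qed

lemma dilate_by_1 [simp]: "dilate 1 f = f"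
  by (simp add: dilate_def)

lemma dilate_sum:
  assumes "c \<noteq> 0"
  shows "dilate c (sum f A) = (\<Sum>x\<in>A. dilate c (f x))"
  using assms by (induction A rule: infinite_finite_induct) (simp_all add: dilate_add)

section \<open>Rings of operators\<close>

text \<open>Common frame for both kinds of operators. The coefficients are sequences in one instance
  and rational functions in the other; \<open>tau\<close> records how a shift changes a coefficient
  that it passes.\<close>

locale skew_operators =
  fixes act :: "'c::comm_ring_1 \<Rightarrow> 'm::ab_group_add \<Rightarrow> 'm"
    and tau :: "int \<Rightarrow> 'c \<Rightarrow> 'c" and sig :: "int \<Rightarrow> 'm \<Rightarrow> 'm"
  assumes act_add_left: "act (a + b) x = act a x + act b x"
    and act_add_right: "act a (x + y) = act a x + act a y"
    and act_mult: "act (a * b) x = act a (act b x)"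
    and act_1: "act 1 x = x"
    and sig_add: "sig i (x + y) = sig i x + sig i y"
    and sig_sig: "sig i (sig j x) = sig (i + j) x"
    and sig_0: "sig 0 x = x"
    and sig_act: "sig i (act c x) = act (tau i c) (sig i x)"
    and tau_0: "tau i 0 = 0"
begin

definition op :: "(int \<Rightarrow> 'c) \<Rightarrow> 'm \<Rightarrow> 'm" where
  "op D x = (\<Sum>j | D j \<noteq> 0. act (D j) (sig j x))"

definition ops :: "('m \<Rightarrow> 'm) set" where
  "ops = {op D |D. finite {j. D j \<noteq> 0}}"

definition has_order :: "('m \<Rightarrow> 'm) \<Rightarrow> int \<Rightarrow> bool" where
  "has_order P d \<longleftrightarrow> (\<exists>D. finite {j. D j \<noteq> 0} \<and> P = op D \<and> D d \<noteq> 0 \<and> (\<forall>j>d. D j = 0))"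

lemma act_0_left [simp]: "act 0 x = 0"
  using act_add_left[of 0 0 x] by simp

lemma act_0_right [simp]: "act a 0 = 0"
  using act_add_right[of a 0 0] by simp

lemma sig_0_right [simp]: "sig i 0 = 0"
  using sig_add[of i 0 0] by simp

lemma act_sum_left: "act (sum f A) x = (\<Sum>a\<in>A. act (f a) x)"
  by (induction A rule: infinite_finite_induct) (simp_all add: act_add_left)

lemma act_sum_right: "act c (sum f A) = (\<Sum>a\<in>A. act c (f a))"
  by (induction A rule: infinite_finite_induct) (simp_all add: act_add_right)

lemma sig_sum: "sig i (sum f A) = (\<Sum>a\<in>A. sig i (f a))"
  by (induction A rule: infinite_finite_induct) (simp_all add: sig_add)

lemma op_eq_sum:
  assumes "finite S" "{j. D j \<noteq> 0} \<subseteq> S"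
  shows "op D x = (\<Sum>j\<in>S. act (D j) (sig j x))"
  unfolding op_def by (rule sum.mono_neutral_left) (use assms in auto)

lemma op_add:
  assumes "finite {j. D j \<noteq> 0}" "finite {j. D' j \<noteq> 0}"
  shows "op (\<lambda>j. D j + D' j) x = op D x + op D' x"
proof -
  define S where "S = {j. D j \<noteq> 0} \<union> {j. D' j \<noteq> 0}"
  have S: "finite S" using assms by (simp add: S_def)
  have "op (\<lambda>j. D j + D' j) x = (\<Sum>j\<in>S. act (D j + D' j) (sig j x))"
    by (rule op_eq_sum) (use S in \<open>auto simp: S_def\<close>)
  also have "\<dots> = (\<Sum>j\<in>S. act (D j) (sig j x)) + (\<Sum>j\<in>S. act (D' j) (sig j x))"
    by (simp add: act_add_left sum.distrib)
  also have "\<dots> = op D x + op D' x"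
    by (subst (1 2) op_eq_sum[of S]) (use S in \<open>auto simp: S_def\<close>)
  finally show ?thesis .
qed

text \<open>The product is a twisted convolution: moving \<open>sig i\<close> past the coefficient
  \<open>D' j\<close> turns it into \<open>tau i (D' j)\<close>, and the terms are collected by l =
  i + j. All such l lie in the sumset \<open>T\<close> of the supports, over which the two finite
  sums can be exchanged.\<close>

lemma op_op:
  assumes "finite {j. D j \<noteq> 0}" "finite {j. D' j \<noteq> 0}"
  shows "op D (op D' x) = op (\<lambda>l. \<Sum>i | D i \<noteq> 0. D i * tau i (D' (l - i))) x"
    and "finite {l. (\<Sum>i | D i \<noteq> 0. D i * tau i (D' (l - i))) \<noteq> 0}"
proof -
  let ?S = "{j. D j \<noteq> 0}" and ?S' = "{j. D' j \<noteq> 0}"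
  define T where "T = (\<lambda>(i, j). i + j) ` (?S \<times> ?S')"
  have T: "finite T" using assms by (simp add: T_def)
  have "i \<in> ?S \<Longrightarrow> D' (l - i) \<noteq> 0 \<Longrightarrow> l \<in> T" for i l
    unfolding T_def by (rule image_eqI[of _ _ "(i, l - i)"]) auto
  then have supp: "{l. (\<Sum>i\<in>?S. D i * tau i (D' (l - i))) \<noteq> 0} \<subseteq> T"
    by (force simp: tau_0 intro: sum.neutral)
  then show "finite {l. (\<Sum>i\<in>?S. D i * tau i (D' (l - i))) \<noteq> 0}"
    using T finite_subset by blast
  have inner: "(\<Sum>l\<in>T. act (D i * tau i (D' (l - i))) (sig l x)) =
      (\<Sum>j\<in>?S'. act (D i * tau i (D' j)) (sig (i + j) x))" if i: "i \<in> ?S" for i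
  proof -
    have "(\<Sum>j\<in>?S'. act (D i * tau i (D' j)) (sig (i + j) x)) =
        (\<Sum>l\<in>(+) i ` ?S'. act (D i * tau i (D' (l - i))) (sig l x))"
      by (subst sum.reindex) (auto simp: o_def)
    also have "\<dots> = (\<Sum>l\<in>T. act (D i * tau i (D' (l - i))) (sig l x))"
    proof (rule sum.mono_neutral_left)
      show "(+) i ` ?S' \<subseteq> T" using i unfolding T_def by force
      show "\<forall>l\<in>T - (+) i ` ?S'. act (D i * tau i (D' (l - i))) (sig l x) = 0"
      proof
        fix l assume "l \<in> T - (+) i ` ?S'"
        then have "D' (l - i) = 0"
          by (metis (mono_tags, lifting) DiffD2 add_diff_cancel_left' diff_add_cancel image_eqI mem_Collect_eq add.commute)
        then show "act (D i * tau i (D' (l - i))) (sig l x) = 0" by (simp add: tau_0)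
      qed
    qed (fact T)
    finally show ?thesis by simp
  qed
  have "op D (op D' x) = (\<Sum>i\<in>?S. \<Sum>j\<in>?S'. act (D i * tau i (D' j)) (sig (i + j) x))"
    unfolding op_def by (simp add: act_sum_right sig_sum sig_act sig_sig act_mult)
  also have "\<dots> = (\<Sum>i\<in>?S. \<Sum>l\<in>T. act (D i * tau i (D' (l - i))) (sig l x))"
    by (rule sum.cong) (use inner in auto)
  also have "\<dots> = (\<Sum>l\<in>T. act (\<Sum>i\<in>?S. D i * tau i (D' (l - i))) (sig l x))"
    by (subst sum.swap) (simp add: act_sum_left)
  also have "\<dots> = op (\<lambda>l. \<Sum>i\<in>?S. D i * tau i (D' (l - i))) x"
    by (rule op_eq_sum[symmetric]) (use T supp in auto)
  finally show "op D (op D' x) = op (\<lambda>l. \<Sum>i\<in>?S. D i * tau i (D' (l - i))) x" .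
qed

lemma monomial_eq_op: "act c (sig j x) = op (\<lambda>i. if i = j then c else 0) x"
  by (subst op_eq_sum[of "{j}"]) auto

lemma monomial_in_ops: "(\<lambda>x. act c (sig j x)) \<in> ops"
  unfolding ops_def monomial_eq_op
  by (auto intro!: exI[of _ "\<lambda>i. if i = j then c else 0"] simp: fun_eq_iff)

lemma act_in_ops: "act c \<in> ops"
  using monomial_in_ops[of c 0] by (simp add: sig_0)

lemma sig_in_ops: "sig j \<in> ops"
  using monomial_in_ops[of 1 j] by (simp add: act_1)

lemma id_in_ops: "id \<in> ops"
proof -
  have "act 1 = id" by (rule ext) (simp add: act_1)
  then show ?thesis using act_in_ops[of 1] by simp
qed

lemma zero_in_ops: "(\<lambda>x. 0) \<in> ops"
proof -
  have "act 0 = (\<lambda>x. 0)" by (rule ext) simp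
  then show ?thesis using act_in_ops[of 0] by simp
qed

lemma add_in_ops: "P \<in> ops \<Longrightarrow> Q \<in> ops \<Longrightarrow> (\<lambda>x. P x + Q x) \<in> ops"
proof -
  assume "P \<in> ops" "Q \<in> ops"
  then obtain D D' where D: "P = op D" "finite {j. D j \<noteq> 0}" "Q = op D'" "finite {j. D' j \<noteq> 0}"
    by (auto simp: ops_def)
  have "finite {j. D j + D' j \<noteq> 0}"
    by (rule finite_subset[of _ "{j. D j \<noteq> 0} \<union> {j. D' j \<noteq> 0}"]) (use D in auto)
  then show ?thesis
    using D unfolding ops_def
    by (auto intro!: exI[of _ "\<lambda>j. D j + D' j"] simp: op_add fun_eq_iff)
qed

lemma comp_in_ops:
  assumes "P \<in> ops" "Q \<in> ops" shows "P \<circ> Q \<in> ops"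
proof -
  obtain D D' where D: "P = op D" "finite {j. D j \<noteq> 0}" "Q = op D'" "finite {j. D' j \<noteq> 0}"
    using assms by (auto simp: ops_def)
  have "P \<circ> Q = op (\<lambda>l. \<Sum>i | D i \<noteq> 0. D i * tau i (D' (l - i)))"
    unfolding D(1,3) o_def by (rule ext) (rule op_op(1)[OF D(2,4)])
  then show ?thesis
    unfolding ops_def using op_op(2)[OF D(2,4)] by blast
qed

lemma sum_in_ops:
  assumes "\<And>a. a \<in> A \<Longrightarrow> P a \<in> ops"
  shows "(\<lambda>x. \<Sum>a\<in>A. P a x) \<in> ops"
  using assms
  by (induction A rule: infinite_finite_induct) (auto simp: zero_in_ops intro: add_in_ops)

lemma ops_add:
  assumes "P \<in> ops" shows "P (x + y) = P x + P y"
proof -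
  obtain D where "P = op D" using assms by (auto simp: ops_def)
  then show ?thesis by (simp add: op_def sig_add act_add_right sum.distrib)
qed

lemma ops_0: "P \<in> ops \<Longrightarrow> P 0 = 0"
  using ops_add[of P 0 0] by simp

lemma ops_sum: "P \<in> ops \<Longrightarrow> P (sum f A) = (\<Sum>a\<in>A. P (f a))"
  by (induction A rule: infinite_finite_induct) (simp_all add: ops_add ops_0)

lemma exists_has_order:
  assumes "P \<in> ops" "P x \<noteq> 0" shows "\<exists>d. has_order P d"
proof -
  obtain D where D: "P = op D" "finite {j. D j \<noteq> 0}" using assms(1) by (auto simp: ops_def)
  have "{j. D j \<noteq> 0} \<noteq> {}"
  proof
    assume "{j. D j \<noteq> 0} = {}"
    then show False using assms(2) by (simp add: D(1) op_def)
  qed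
  then have "Max {j. D j \<noteq> 0} \<in> {j. D j \<noteq> 0}" "\<forall>j>Max {j. D j \<noteq> 0}. D j = 0"
    using Max_in[OF D(2)] Max_ge[OF D(2)] by (force, force)
  then show ?thesis
    using D unfolding has_order_def by blast
qed

text \<open>The coefficient at a + b reduces to the single term \<open>D a * tau a (D' b)\<close>.
  Sequences have zero divisors, so that it does not vanish is the hypothesis \<open>nzd\<close>;
  rational functions satisfy it.\<close>

lemma has_order_comp:
  assumes nzd: "\<And>a b i. a \<noteq> 0 \<Longrightarrow> b \<noteq> 0 \<Longrightarrow> a * tau i b \<noteq> 0"
    and P: "has_order P a" and Q: "has_order Q b"
  shows "has_order (P \<circ> Q) (a + b)"
proof -
  obtain D where D: "finite {j. D j \<noteq> 0}" "P = op D" "D a \<noteq> 0" "\<forall>j>a. D j = 0"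
    using P by (auto simp: has_order_def)
  obtain D' where D': "finite {j. D' j \<noteq> 0}" "Q = op D'" "D' b \<noteq> 0" "\<forall>j>b. D' j = 0"
    using Q by (auto simp: has_order_def)
  let ?C = "\<lambda>l. \<Sum>i | D i \<noteq> 0. D i * tau i (D' (l - i))"
  have "?C (a + b) = (\<Sum>i\<in>{a}. D i * tau i (D' (a + b - i)))"
  proof (rule sum.mono_neutral_right)
    show "\<forall>i\<in>{j. D j \<noteq> 0} - {a}. D i * tau i (D' (a + b - i)) = 0"
    proof
      fix i assume "i \<in> {j. D j \<noteq> 0} - {a}"
      then have "i < a" using D(4) by force
      then show "D i * tau i (D' (a + b - i)) = 0" using D'(4) by (simp add: tau_0)
    qed
  qed (use D in auto)
  then have top: "?C (a + b) \<noteq> 0" using nzd D(3) D'(3) by simp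
  have "?C l = 0" if "l > a + b" for l
  proof (rule sum.neutral, rule ballI)
    fix i assume "i \<in> {j. D j \<noteq> 0}"
    then have "i \<le> a" using D(4) by force
    then show "D i * tau i (D' (l - i)) = 0" using that D'(4) by (simp add: tau_0)
  qed
  moreover have "P \<circ> Q = op ?C"
    unfolding D(2) D'(2) o_def by (rule ext) (rule op_op(1)[OF D(1) D'(1)])
  ultimately show ?thesis
    unfolding has_order_def using top op_op(2)[OF D(1) D'(1)]
    by (intro exI[of _ ?C] conjI) auto
qed

end

text \<open>Here \<open>rep f P\<close> stands for "P has the eigenvalue f on the wave function".
  Operators are picked by choice; because an operator is determined by its eigenvalue, the choice is
  automatically additive and multiplicative.\<close>

lemma operator_ring_iso:
  fixes A :: "ratfun set" and rep :: "ratfun \<Rightarrow> ('a::ab_group_add \<Rightarrow> 'a) \<Rightarrow> bool"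
  assumes A: "0 \<in> A" "1 \<in> A" "\<And>f g. f \<in> A \<Longrightarrow> g \<in> A \<Longrightarrow> f + g \<in> A"
      "\<And>f g. f \<in> A \<Longrightarrow> g \<in> A \<Longrightarrow> f * g \<in> A" "\<And>f. f \<in> A \<Longrightarrow> - f \<in> A"
    and ex: "\<And>f. f \<in> A \<Longrightarrow> \<exists>P. rep f P"
    and rep_0: "rep 0 (\<lambda>x. 0)" and rep_1: "rep 1 id"
    and rep_add: "\<And>f g P Q. rep f P \<Longrightarrow> rep g Q \<Longrightarrow> rep (f + g) (\<lambda>x. P x + Q x)"
    and rep_mult: "\<And>f g P Q. rep f P \<Longrightarrow> rep g Q \<Longrightarrow> rep (f * g) (P \<circ> Q)"
    and rep_unique: "\<And>f P Q. rep f P \<Longrightarrow> rep f Q \<Longrightarrow> P = Q"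
    and rep_inj: "\<And>f g P. f \<in> A \<Longrightarrow> g \<in> A \<Longrightarrow> rep f P \<Longrightarrow> rep g P \<Longrightarrow> f = g"
  obtains L where "\<And>f. f \<in> A \<Longrightarrow> rep f (L f)" "cring (op_ring (L ` A))"
    "L \<in> ring_iso (func_ring A) (op_ring (L ` A))"
proof -
  define L where "L f = (SOME P. rep f P)" for f
  have L: "rep f (L f)" if "f \<in> A" for f
    unfolding L_def using ex[OF that] by (rule someI_ex)
  have hom: "L 0 = (\<lambda>x. 0)" "L 1 = id"
    "\<And>f g. f \<in> A \<Longrightarrow> g \<in> A \<Longrightarrow> L (f + g) = (\<lambda>x. L f x + L g x)"
    "\<And>f g. f \<in> A \<Longrightarrow> g \<in> A \<Longrightarrow> L (f * g) = L f \<circ> L g"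
    by (rule rep_unique, rule L, simp add: A, simp add: rep_0 rep_1 rep_add rep_mult L A)+
  interpret F: cring "func_ring A"
  proof (intro cringI abelian_groupI comm_monoidI)
    fix f assume "f \<in> carrier (func_ring A)"
    then show "\<exists>g\<in>carrier (func_ring A). g \<oplus>\<^bsub>func_ring A\<^esub> f = \<zero>\<^bsub>func_ring A\<^esub>"
      using A(5) by (auto simp: func_ring_def intro!: bexI[of _ "- f"])
  qed (use A in \<open>auto simp: func_ring_def algebra_simps\<close>)
  have "inj_on L A"
    using L rep_inj by (metis inj_onI)
  then have iso: "L \<in> ring_iso (func_ring A) (op_ring (L ` A))"
    unfolding ring_iso_def Ring.ring_hom_def
    using hom by (auto simp: func_ring_def op_ring_def bij_betw_def)
  \<comment> \<open>The transport of \<open>cring\<close> along an isomorphism produces the target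
    ring with its zero replaced by the image of zero, which is the same ring here.\<close>
  have "op_ring (L ` A)\<lparr>ring.zero := L \<zero>\<^bsub>func_ring A\<^esub>\<rparr> = op_ring (L ` A)"
    by (simp add: op_ring_def func_ring_def hom)
  then have "cring (op_ring (L ` A))"
    using F.ring_iso_imp_img_cring[OF iso] by simp
  then show ?thesis using that L iso by blast
qed

lemma antimono_int_chain:
  assumes dec: "\<And>n::int. V (n + 1) \<subseteq> V n" and "m \<le> n"
  shows "V n \<subseteq> V m"
  using assms(2) by (induction rule: int_ge_induct) (use dec in blast)+

section \<open>Difference and dilation operators\<close>

lemma sum_fun_apply: "(\<Sum>a\<in>A. F a) x = (\<Sum>a\<in>A. F a x)"
  by (induction A rule: infinite_finite_induct) simp_all

global_interpretation dop: skew_operators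
  "\<lambda>(c :: int \<Rightarrow> complex) (\<phi> :: int \<Rightarrow> ratfun) n. const (c n) * \<phi> n"
  "\<lambda>i c n. c (n + i)" "\<lambda>i \<phi> n. \<phi> (n + i)"
  by unfold_locales (auto simp: fun_eq_iff algebra_simps const_add const_mult const_1)

lemma dop_op_eq: "dop.op h = diff_op h"
  by (simp add: fun_eq_iff dop.op_def diff_op_def sum_fun_apply)

lemma dop_ops_eq: "dop.ops = diff_ops"
  by (simp add: dop.ops_def diff_ops_def dop_op_eq)

lemma diff_op_mult: "diff_op h (\<lambda>n. f * \<phi> n) = (\<lambda>n. f * diff_op h \<phi> n)"
  by (simp add: fun_eq_iff diff_op_def sum_distrib_left mult.left_commute)

section \<open>Powers of q, dilations, and polynomials in a dilation\<close>

locale q_shift =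
  fixes q :: real
  assumes q_pos: "0 < q" and q_less_1: "q < 1"
begin

abbreviation Q :: complex where "Q \<equiv> complex_of_real q"

lemma q_neq_0 [simp]: "q \<noteq> 0"
  using q_pos by simp

lemma inj_Q_powi: "inj (\<lambda>n. Q powi n)"
proof (rule injI)
  fix m n assume "Q powi m = Q powi n"
  then have "q powi m = q powi n"
    by (metis of_real_eq_iff of_real_power_int)
  then show "m = n"
    using power_int_strict_decreasing[of m n q] power_int_strict_decreasing[of n m q] q_pos q_less_1
    by (cases m n rule: linorder_cases) auto
qed

lemma poly_eq_0_if_Q_powi:
  fixes p :: "complex poly"
  assumes "\<And>n. poly p (Q powi n) = 0"
  shows "p = 0"
proof (rule ccontr)
  assume "p \<noteq> 0"
  then have "finite {x. poly p x = 0}"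
    by (rule poly_roots_finite)
  then have "finite (range (\<lambda>n. Q powi n))"
    by (rule finite_subset[rotated]) (use assms in auto)
  then show False
    using finite_imageD inj_Q_powi infinite_UNIV_int by blast
qed

sublocale qop: skew_operators "(*) :: ratfun \<Rightarrow> ratfun \<Rightarrow> ratfun"
  "\<lambda>j. dilate (Q powi j)" "\<lambda>j. dilate (Q powi j)"
  by unfold_locales (simp_all add: algebra_simps dilate_add dilate_mult dilate_dilate power_int_add)

lemma qop_op_eq: "qop.op D = qdiff_op q D"
  by (simp add: fun_eq_iff qop.op_def qdiff_op_def)

lemma qop_ops_eq: "qop.ops = qdiff_ops q"
  by (simp add: qop.ops_def qdiff_ops_def qop_op_eq)

lemma qop_has_order_eq: "qop.has_order = qdiff_has_order q"
  by (simp add: fun_eq_iff qop.has_order_def qdiff_has_order_def qop_op_eq)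

lemma qop_has_order_comp:
  "qop.has_order P a \<Longrightarrow> qop.has_order R b \<Longrightarrow> qop.has_order (P \<circ> R) (a + b)"
  by (rule qop.has_order_comp) (auto simp: dilate_eq_0_iff)

lemma qop_const_mult:
  assumes "P \<in> qop.ops"
  shows "P (const c * f) = const c * P f"
proof -
  obtain D where "P = qop.op D" using assms by (auto simp: qop.ops_def)
  then show ?thesis
    by (simp add: qop.op_def dilate_mult sum_distrib_left mult.left_commute)
qed

lemma dilate_Z_powi: "dilate (Q powi j) (Z powi n) = const ((Q powi n) powi j) * Z powi n"
  by (simp add: dilate_powi dilate_Z power_int_mult_distrib flip: const_powi power_int_mult)
    (simp add: mult.commute)

text \<open>On z^n the operator acts as multiplication by the sum of D_j x^j with x = Q^n, where the
  D_j do not depend on n. This is a Laurent polynomial in x over the field of rational functions,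
  with infinitely many roots.\<close>

lemma op_eq_0_if_kills_powers:
  assumes fin: "finite {j. D j \<noteq> 0}" and kill: "\<And>n. qop.op D (Z powi n) = 0"
  shows "D = (\<lambda>j. 0)"
proof -
  let ?S = "{j. D j \<noteq> 0}"
  \<comment> \<open>Multiplication by x^(-N) turns the Laurent polynomial into a polynomial.\<close>
  obtain N where N: "\<And>j. j \<in> ?S \<Longrightarrow> N \<le> j"
    using Min_le[OF fin] by blast
  define p where "p = (\<Sum>j\<in>?S. Polynomial.monom (D j) (nat (j - N)))"
  have root: "poly p (const (Q powi n)) = 0" for n
  proof -
    let ?x = "const (Q powi n)"
    have x0: "?x \<noteq> 0" by simp
    have "?x powi N * poly p ?x = (\<Sum>j\<in>?S. D j * (?x powi N * ?x ^ nat (j - N)))"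
      by (simp add: p_def poly_sum poly_monom sum_distrib_left mult.left_commute)
    also have "\<dots> = (\<Sum>j\<in>?S. D j * ?x powi j)"
    proof (rule sum.cong[OF refl])
      fix j assume "j \<in> ?S"
      then have "N \<le> j" by (rule N)
      then have "?x ^ nat (j - N) = ?x powi (j - N)"
        by (simp add: power_int_def)
      then show "D j * (?x powi N * ?x ^ nat (j - N)) = D j * ?x powi j"
        using x0 by (simp flip: power_int_add)
    qed
    finally have 1: "?x powi N * poly p ?x = (\<Sum>j\<in>?S. D j * ?x powi j)" .
    have "(\<Sum>j\<in>?S. D j * ?x powi j) * Z powi n = qop.op D (Z powi n)"
      unfolding qop.op_def dilate_Z_powi const_powi by (simp add: sum_distrib_right mult.assoc)
    then have "(\<Sum>j\<in>?S. D j * ?x powi j) = 0"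
      using kill by simp
    with 1 x0 show ?thesis by simp
  qed
  have "p = 0"
  proof (rule ccontr)
    assume "p \<noteq> 0"
    then have "finite {x. poly p x = 0}"
      by (rule poly_roots_finite)
    then have "finite (range (\<lambda>n. const (Q powi n)))"
      by (rule finite_subset[rotated]) (use root in auto)
    moreover have "inj (\<lambda>n. const (Q powi n))"
      using inj_Q_powi by (auto simp: inj_def)
    ultimately show False
      using finite_imageD infinite_UNIV_int by blast
  qed
  have "D j = 0" for j
  proof (rule ccontr)
    assume j: "D j \<noteq> 0"
    have "poly.coeff p (nat (j - N)) = (\<Sum>i\<in>?S. if i = j then D i else 0)"
      unfolding p_def coeff_sum coeff_monom
      by (rule sum.cong) (use N j in \<open>force simp: nat_eq_iff\<close>)+
    then show False using \<open>p = 0\<close> j fin by simp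
  qed
  then show ?thesis by (rule ext)
qed

lemma has_order_not_kills_powers:
  assumes "qop.has_order P d"
  shows "\<exists>n. P (Z powi n) \<noteq> 0"
  using assms op_eq_0_if_kills_powers unfolding qop.has_order_def by metis

text \<open>This is a(D) for the dilation D by \<open>Q\<close>. The coefficients are complex
  constants, so these operators commute with each other and multiply like polynomials, which is what
  the elimination in \<open>R_op_wave\<close> rests on.\<close>

definition poly_dil :: "complex poly \<Rightarrow> ratfun \<Rightarrow> ratfun" where
  "poly_dil a f = (\<Sum>i\<le>degree a. const (poly.coeff a i) * dilate (Q ^ i) f)"

lemma poly_dil_eq_sum:
  assumes "degree a \<le> n"
  shows "poly_dil a f = (\<Sum>i\<le>n. const (poly.coeff a i) * dilate (Q ^ i) f)"
  unfolding poly_dil_def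
  by (rule sum.mono_neutral_left) (use assms in \<open>auto simp: coeff_eq_0\<close>)

lemma poly_dil_0 [simp]: "poly_dil 0 f = 0"
  by (simp add: poly_dil_def)

lemma poly_dil_pCons: "poly_dil (pCons c a) f = const c * f + dilate Q (poly_dil a f)"
proof -
  have "poly_dil (pCons c a) f =
      (\<Sum>i\<le>Suc (degree a). const (poly.coeff (pCons c a) i) * dilate (Q ^ i) f)"
    by (rule poly_dil_eq_sum) (rule degree_pCons_le)
  also have "\<dots> = const c * f + dilate Q (poly_dil a f)"
    by (subst sum.atMost_Suc_shift)
      (simp add: poly_dil_def dilate_sum dilate_mult dilate_dilate)
  finally show ?thesis .
qed

lemma poly_dil_add: "poly_dil (a + b) f = poly_dil a f + poly_dil b f"
proof -
  define n where "n = max (degree a) (degree b)"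
  have "degree a \<le> n" "degree b \<le> n" "degree (a + b) \<le> n"
    by (auto simp: n_def degree_add_le_max)
  then show ?thesis
    by (simp add: poly_dil_eq_sum[of _ n] const_add algebra_simps sum.distrib)
qed

lemma poly_dil_smult: "poly_dil (Polynomial.smult c a) f = const c * poly_dil a f"
  by (induction a) (simp_all add: poly_dil_pCons const_mult dilate_mult algebra_simps)

lemma poly_dil_mult: "poly_dil (a * b) f = poly_dil a (poly_dil b f)"
  by (induction a)
    (simp_all add: poly_dil_pCons poly_dil_add poly_dil_smult)

lemma poly_dil_sum: "poly_dil (\<Sum>x\<in>A. a x) f = (\<Sum>x\<in>A. poly_dil (a x) f)"
  by (induction A rule: infinite_finite_induct) (simp_all add: poly_dil_add)

lemma poly_dil_monom: "poly_dil (Polynomial.monom c n) f = const c * dilate (Q ^ n) f"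
  by (induction n) (simp_all add: monom_0 monom_Suc poly_dil_pCons dilate_mult dilate_dilate)

lemma poly_dil_Z_powi: "poly_dil a (Z powi n) = const (poly a (Q powi n)) * Z powi n"
  using dilate_Z_powi[of 1 n]
  by (induction a) (simp_all add: poly_dil_pCons dilate_mult const_add const_mult algebra_simps)

lemma poly_dil_in_ops: "poly_dil a \<in> qop.ops"
proof -
  have "(\<lambda>x. \<Sum>i\<le>degree a. const (poly.coeff a i) * dilate (Q powi int i) x) \<in> qop.ops"
    by (intro qop.sum_in_ops qop.monomial_in_ops)
  moreover have "poly_dil a = (\<lambda>x. \<Sum>i\<le>degree a. const (poly.coeff a i) * dilate (Q powi int i) x)"
    by (rule ext) (simp add: poly_dil_def)
  ultimately show ?thesis by simp
qed

lemma mult_in_ops: "(\<lambda>x. f * x) \<in> qop.ops"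
  by (rule qop.act_in_ops)

end

section \<open>Bordered determinants and partial fractions\<close>

text \<open>The cofactors of the last column of a bordered matrix: they depend only on the other columns.\<close>

definition border_cof :: "nat \<Rightarrow> (nat \<Rightarrow> nat \<Rightarrow> 'a::comm_ring_1) \<Rightarrow> nat \<Rightarrow> 'a" where
  "border_cof g c i = (- 1) ^ (i + g) * det (mat g g (\<lambda>(i', j). c (if i' < i then i' else Suc i') j))"

lemma border_cof_last: "border_cof g c g = det (mat g g (\<lambda>(i, j). c i j))"
proof -
  have "mat g g (\<lambda>(i', j). c (if i' < g then i' else Suc i') j) = mat g g (\<lambda>(i, j). c i j)"
    by (rule eq_matI) auto
  moreover have "(- 1 :: 'a) ^ (g + g) = 1" by (metis power_minus1_even mult_2)
  ultimately show ?thesis unfolding border_cof_def by simp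
qed

lemma det_border:
  "det (mat (g + 1) (g + 1) (\<lambda>(i, j). if j < g then c i j else v i)) =
    (\<Sum>i\<le>g. v i * border_cof g c i)"
proof -
  let ?A = "mat (g + 1) (g + 1) (\<lambda>(i, j). if j < g then c i j else v i)"
  have "det ?A = (\<Sum>i<g + 1. ?A $$ (i, g) * cofactor ?A i g)"
    by (rule laplace_expansion_column) auto
  also have "\<dots> = (\<Sum>i<g + 1. v i * border_cof g c i)"
  proof (rule sum.cong[OF refl])
    fix i assume i: "i \<in> {..<g + 1}"
    have "mat_delete ?A i g = mat g g (\<lambda>(i', j). c (if i' < i then i' else Suc i') j)"
      by (rule eq_matI) (use i in \<open>auto simp: mat_delete_def\<close>)
    then show "?A $$ (i, g) * cofactor ?A i g = v i * border_cof g c i"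
      using i by (simp add: cofactor_def border_cof_def)
  qed
  finally show ?thesis by (simp add: lessThan_Suc_atMost)
qed

text \<open>The sum is the expansion of a bordered determinant whose last column repeats column
  \<open>j\<close>.\<close>

lemma border_cof_orthogonal:
  assumes "j < g"
  shows "(\<Sum>i\<le>g. c i j * border_cof g c i) = 0"
proof -
  have "(\<Sum>i\<le>g. c i j * border_cof g c i) =
      det (mat (g + 1) (g + 1) (\<lambda>(i, j'). if j' < g then c i j' else c i j))"
    by (simp only: det_border)
  also have "\<dots> = 0"
  proof (rule det_identical_columns[of _ "g + 1" j g])
    show "col (mat (g + 1) (g + 1) (\<lambda>(i, j'). if j' < g then c i j' else c i j)) j =
        col (mat (g + 1) (g + 1) (\<lambda>(i, j'). if j' < g then c i j' else c i j)) g"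
      by (rule eq_vecI) (use assms in auto)
  qed (use assms in auto)
  finally show ?thesis .
qed

text \<open>Cofactors are polynomial expressions in the entries. The two instances below embed
  complex determinants into the rational functions and evaluate polynomial determinants at a
  point.\<close>

lemma (in comm_ring_hom) hom_border_cof:
  "hom (border_cof g c i) = border_cof g (\<lambda>i j. hom (c i j)) i"
proof -
  have "mat g g (\<lambda>(i', j). hom (c (if i' < i then i' else Suc i') j)) =
      map_mat hom (mat g g (\<lambda>(i', j). c (if i' < i then i' else Suc i') j))"
    by (rule eq_matI) auto
  then show ?thesis
    unfolding border_cof_def by (simp add: hom_distribs)
qed

lemma border_cof_const: "const (border_cof g c i) = border_cof g (\<lambda>i j. const (c i j)) i"
proof -
  interpret comm_ring_hom const
    by unfold_locales (simp_all add: const_1 const_add const_mult)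
  show ?thesis by (rule hom_border_cof)
qed

lemma border_cof_poly: "poly (border_cof g c i) x = border_cof g (\<lambda>i j. poly (c i j) x) i"
proof -
  interpret comm_ring_hom "\<lambda>p. poly p x"
    by unfold_locales simp_all
  show ?thesis by (rule hom_border_cof)
qed

lemma mult_mat_vec_mat_transpose:
  fixes c :: "nat \<Rightarrow> nat \<Rightarrow> 'a::comm_semiring_0"
  assumes "j < g" "w \<in> carrier_vec g"
  shows "((mat g g (\<lambda>(i, j). c i j))\<^sup>T *\<^sub>v w) $ j = (\<Sum>i<g. w $ i * c i j)"
  using assms by (simp add: scalar_prod_def atLeast0LessThan mult.commute)

lemma kernel_trivial_if_det_neq_0:
  fixes c :: "nat \<Rightarrow> nat \<Rightarrow> 'a::field"
  assumes det: "det (mat g g (\<lambda>(i, j). c i j)) \<noteq> 0"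
    and ker: "\<And>j. j < g \<Longrightarrow> (\<Sum>i<g. v i * c i j) = 0" and i: "i < g"
  shows "v i = 0"
proof -
  let ?A = "(mat g g (\<lambda>(i, j). c i j))\<^sup>T"
  have A: "?A \<in> carrier_mat g g" by simp
  have "det ?A \<noteq> 0" using det by (subst det_transpose[of _ g]) auto
  moreover have "?A *\<^sub>v vec g v = 0\<^sub>v g"
    by (rule eq_vecI) (use ker in \<open>auto simp: mult_mat_vec_mat_transpose simp del: index_mult_mat_vec\<close>)
  ultimately have "vec g v = 0\<^sub>v g"
    using det_0_iff_vec_prod_zero_field[OF A] by (metis vec_carrier)
  then show ?thesis using i by (metis index_vec index_zero_vec(1))
qed

text \<open>A kernel vector of the transpose is the coefficient vector of a polynomial of degree
  less than g that vanishes at the g distinct points \<open>a j\<close>.\<close>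

lemma det_scaled_vandermonde_neq_0:
  fixes a d :: "nat \<Rightarrow> 'a::field"
  assumes inj: "inj_on a {..<g}" and d: "\<And>j. j < g \<Longrightarrow> d j \<noteq> 0"
  shows "det (mat g g (\<lambda>(i, j). d j * a j ^ i)) \<noteq> 0"
proof
  let ?A = "(mat g g (\<lambda>(i, j). d j * a j ^ i))\<^sup>T"
  assume "det (mat g g (\<lambda>(i, j). d j * a j ^ i)) = 0"
  then have "det ?A = 0" by (subst det_transpose[of _ g]) auto
  moreover have "?A \<in> carrier_mat g g" by simp
  ultimately obtain w where w: "w \<in> carrier_vec g" "w \<noteq> 0\<^sub>v g" "?A *\<^sub>v w = 0\<^sub>v g"
    using det_0_iff_vec_prod_zero_field by blast
  define p where "p = (\<Sum>i<g. Polynomial.monom (w $ i) i)"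
  have coeff: "poly.coeff p i = (if i < g then w $ i else 0)" for i
    by (simp add: p_def coeff_sum)
  have "poly p (a j) = 0" if "j < g" for j
  proof -
    have "0 = (?A *\<^sub>v w) $ j" using w(3) that by simp
    also have "\<dots> = (\<Sum>i<g. w $ i * (d j * a j ^ i))"
      using that w(1) by (rule mult_mat_vec_mat_transpose)
    also have "\<dots> = d j * poly p (a j)"
      by (simp add: p_def poly_sum poly_monom sum_distrib_left mult.left_commute)
    finally show ?thesis using d[OF that] by simp
  qed
  moreover have "card (a ` {..<g}) = g" using inj by (simp add: card_image)
  moreover have "degree p < g" if "g > 0"
    using that coeff by (intro degree_lessI) auto
  ultimately have "p = 0" if "g > 0"
    using that by (intro poly_eqI_degree[of "a ` {..<g}"]) auto
  then have "w $ i = 0" if "i < g" for i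
    using coeff[of i] that by auto
  then have "w = 0\<^sub>v g" using w(1) by (intro eq_vecI) auto
  with w(2) show False by simp
qed

text \<open>The degree may reach \<open>card A\<close>, so the Lagrange interpolant is corrected by
  a multiple of the nodal polynomial. Values on \<open>A\<close> and the coefficient at
  \<open>card A\<close> determine such a polynomial. The correction becomes the constant term in
  \<open>partial_fractions\<close>.\<close>

lemma lagrange_interpolation_top:
  fixes H :: "'a::field poly"
  assumes fin: "finite A" and deg: "degree H \<le> card A"
  shows "H = Polynomial.smult (poly.coeff H (card A)) (\<Prod>a\<in>A. [:- a, 1:]) +
    (\<Sum>a\<in>A. Polynomial.smult (inverse (\<Prod>b\<in>A - {a}. a - b) * poly H a) (\<Prod>b\<in>A - {a}. [:- b, 1:]))"
    (is "H = Polynomial.smult ?h ?F + ?S")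
proof (rule poly_eqI_degree_lead_coeff[of _ "card A" _ A])
  have F: "degree ?F = card A" "poly.coeff ?F (card A) = 1"
  proof -
    show *: "degree ?F = card A"
      by (subst degree_prod_eq_sum_degree) auto
    show "poly.coeff ?F (card A) = 1"
      using lead_coeff_prod[of "\<lambda>a. [:- a, 1:]" A] * by simp
  qed
  have S: "poly.coeff ?S i = 0" if "i \<ge> card A" for i
    unfolding coeff_sum
  proof (rule sum.neutral, rule ballI)
    fix a assume a: "a \<in> A"
    have "degree (\<Prod>b\<in>A - {a}. [:- b, 1:]) = card A - 1"
      by (subst degree_prod_eq_sum_degree) (use a fin in \<open>auto simp: card_Diff_singleton\<close>)
    moreover have "card A > 0" using a fin by (auto simp: card_gt_0_iff)
    ultimately show "poly.coeff (Polynomial.smult (inverse (\<Prod>b\<in>A - {a}. a - b) * poly H a)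
        (\<Prod>b\<in>A - {a}. [:- b, 1:])) i = 0"
      using that by (simp add: coeff_eq_0)
  qed
  show "poly.coeff H (card A) = poly.coeff (Polynomial.smult ?h ?F + ?S) (card A)"
    using F(2) S by simp
  show "degree (Polynomial.smult ?h ?F + ?S) \<le> card A"
    using F(1) S by (intro degree_le allI impI) (simp add: coeff_eq_0)
  fix z assume z: "z \<in> A"
  have "poly ?S z = (\<Sum>a\<in>A. if a = z then poly H z else 0)"
    unfolding poly_sum
  proof (rule sum.cong[OF refl])
    fix a assume a: "a \<in> A"
    show "poly (Polynomial.smult (inverse (\<Prod>b\<in>A - {a}. a - b) * poly H a)
        (\<Prod>b\<in>A - {a}. [:- b, 1:])) z = (if a = z then poly H z else 0)"
    proof (cases "a = z")
      case True
      have "(\<Prod>b\<in>A - {z}. z - b) \<noteq> 0" using fin by simp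
      then show ?thesis by (simp add: True poly_prod)
    next
      case False
      then have "(\<Prod>b\<in>A - {a}. z - b) = 0"
        using z fin by (intro prod_zero) auto
      then show ?thesis using False by (simp add: poly_prod)
    qed
  qed
  moreover have "poly ?F z = 0" using z fin by (auto simp: poly_prod)
  ultimately show "poly H z = poly (Polynomial.smult ?h ?F + ?S) z"
    using z fin by simp
qed (use deg in auto)

lemma partial_fractions:
  assumes fin: "finite A" and deg: "degree H \<le> card A"
  shows "to_fract H / (\<Prod>a\<in>A. Z - const a) = const (poly.coeff H (card A)) +
    (\<Sum>a\<in>A. const (inverse (\<Prod>b\<in>A - {a}. a - b) * poly H a) / (Z - const a))"
proof -
  let ?F = "\<Prod>a\<in>A. Z - const a"
  have F: "?F \<noteq> 0" using fin by simp
  have "to_fract H = const (poly.coeff H (card A)) * ?F +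
      (\<Sum>a\<in>A. const (inverse (\<Prod>b\<in>A - {a}. a - b) * poly H a) * (\<Prod>b\<in>A - {a}. Z - const b))"
    by (subst lagrange_interpolation_top[OF fin deg])
      (simp add: to_fract_smult to_fract_prod Z_minus_const)
  also have "(\<Sum>a\<in>A. const (inverse (\<Prod>b\<in>A - {a}. a - b) * poly H a) * (\<Prod>b\<in>A - {a}. Z - const b)) =
      (\<Sum>a\<in>A. const (inverse (\<Prod>b\<in>A - {a}. a - b) * poly H a) / (Z - const a)) * ?F"
    unfolding sum_distrib_right
  proof (rule sum.cong[OF refl])
    fix a assume "a \<in> A"
    then show "const (inverse (\<Prod>b\<in>A - {a}. a - b) * poly H a) * (\<Prod>b\<in>A - {a}. Z - const b) =
      const (inverse (\<Prod>b\<in>A - {a}. a - b) * poly H a) / (Z - const a) * ?F"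
      using fin by (simp add: prod.remove[of A a])
  qed
  finally show ?thesis
    using F by (simp add: divide_simps) (simp add: algebra_simps)
qed

section \<open>The wave function and the difference operators\<close>

lemma flag_ring_shift:
  assumes "f \<in> flag_ring V"
  shows "\<exists>k. \<forall>n. \<forall>v\<in>V n. f * v \<in> V (n + k)"
  using assms unfolding flag_ring_def by blast

lemma flag_ring_closed:
  assumes sub: "\<And>n. cvs.subspace (V n)" and dec: "\<And>n. V (n + 1) \<subseteq> V n"
  shows "0 \<in> flag_ring V" "1 \<in> flag_ring V"
    "\<And>f g. f \<in> flag_ring V \<Longrightarrow> g \<in> flag_ring V \<Longrightarrow> f + g \<in> flag_ring V"
    "\<And>f g. f \<in> flag_ring V \<Longrightarrow> g \<in> flag_ring V \<Longrightarrow> f * g \<in> flag_ring V"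
    "\<And>f. f \<in> flag_ring V \<Longrightarrow> - f \<in> flag_ring V"
proof -
  have const_mem: "const c \<in> flag_ring V" for c
  proof -
    have "\<exists>e p. const c = Z powi e * to_fract p"
      by (rule exI[of _ 0], rule exI[of _ "[:c:]"]) (simp add: const_def)
    moreover have "(\<lambda>v. const c * v) ` V n \<subseteq> V (n + 0)" for n
      using cvs.subspace_scale[OF sub] by auto
    ultimately show ?thesis
      unfolding flag_ring_def laurent_iff by blast
  qed
  show "0 \<in> flag_ring V" "1 \<in> flag_ring V"
    using const_mem[of 0] const_mem[of 1] by (simp_all add: const_1)
  show add: "f + g \<in> flag_ring V" if f: "f \<in> flag_ring V" and g: "g \<in> flag_ring V" for f g
  proof -
    obtain k where k: "\<And>n v. v \<in> V n \<Longrightarrow> f * v \<in> V (n + k)"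
      using flag_ring_shift[of f V] f by blast
    obtain l where l: "\<And>n v. v \<in> V n \<Longrightarrow> g * v \<in> V (n + l)"
      using flag_ring_shift[of g V] g by blast
    \<comment> \<open>The flag decreases, so the smaller shift gives a space that contains both
      products.\<close>
    have "(f + g) * v \<in> V (n + min k l)" if "v \<in> V n" for n v
    proof -
      have "V (n + k) \<subseteq> V (n + min k l)" "V (n + l) \<subseteq> V (n + min k l)"
        by (rule antimono_int_chain[of V, OF dec], simp)+
      then have "f * v \<in> V (n + min k l)" "g * v \<in> V (n + min k l)"
        using k[OF that] l[OF that] by auto
      then show ?thesis
        using cvs.subspace_add[OF sub] by (simp add: distrib_right)
    qed
    moreover have "\<exists>e p. f + g = Z powi e * to_fract p"
    proof -
      obtain e1 p1 where "f = Z powi e1 * to_fract p1"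
        using f unfolding flag_ring_def laurent_iff by blast
      moreover obtain e2 p2 where "g = Z powi e2 * to_fract p2"
        using g unfolding flag_ring_def laurent_iff by blast
      ultimately show ?thesis using laurent_add[of e1 p1 e2 p2] by simp
    qed
    ultimately show ?thesis unfolding flag_ring_def laurent_iff by blast
  qed
  show mult: "f * g \<in> flag_ring V" if f: "f \<in> flag_ring V" and g: "g \<in> flag_ring V" for f g
  proof -
    obtain k where k: "\<And>n v. v \<in> V n \<Longrightarrow> f * v \<in> V (n + k)"
      using flag_ring_shift[of f V] f by blast
    obtain l where l: "\<And>n v. v \<in> V n \<Longrightarrow> g * v \<in> V (n + l)"
      using flag_ring_shift[of g V] g by blast
    obtain e1 p1 where p1: "f = Z powi e1 * to_fract p1"
      using f unfolding flag_ring_def laurent_iff by blast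
    obtain e2 p2 where p2: "g = Z powi e2 * to_fract p2"
      using g unfolding flag_ring_def laurent_iff by blast
    have "f * g = Z powi (e1 + e2) * to_fract (p1 * p2)"
      by (simp add: p1 p2 power_int_add)
    moreover have "(f * g) * v \<in> V (n + (l + k))" if "v \<in> V n" for n v
      using k[OF l[OF that]] by (simp add: mult.assoc add.assoc)
    ultimately show ?thesis unfolding flag_ring_def laurent_iff by blast
  qed
  show "- f \<in> flag_ring V" if "f \<in> flag_ring V" for f
    using mult[OF const_mem[of "- 1"] that] by (simp add: const_minus const_1)
qed

lemma Z_powi_to_fract_eq_iff:
  assumes "m \<le> n"
  shows "Z powi n * to_fract p = Z powi m * to_fract r \<longleftrightarrow> Polynomial.monom 1 (nat (n - m)) * p = r"
proof -
  have "Z powi n = Z powi m * Z ^ nat (n - m)"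
    using assms by (simp add: power_int_add[symmetric] flip: power_int_of_nat)
  then have "Z powi n * to_fract p = Z powi m * to_fract (Polynomial.monom 1 (nat (n - m)) * p)"
    by (simp add: to_fract_monom const_1)
  then show ?thesis by (simp del: to_fract_mult)
qed

text \<open>The number n + degree p is the order of growth of z^n p at infinity, so it is the same
  for all representations. All orders of difference operators are found by comparing it on two
  sides.\<close>

lemma Z_powi_to_fract_eq_degree:
  assumes "Z powi n * to_fract p = Z powi m * to_fract r" "p \<noteq> 0"
  shows "n + int (degree p) = m + int (degree r)" "r \<noteq> 0"
proof -
  show r: "r \<noteq> 0" using assms by (auto simp: power_int_eq_0_iff)
  have *: "n + int (degree p) = m + int (degree r)"
    if "Z powi n * to_fract p = Z powi m * to_fract r" "p \<noteq> 0" "m \<le> n" for m n p r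
    using that Z_powi_to_fract_eq_iff[of m n p r]
    by (auto simp: degree_mult_eq degree_monom_eq monom_eq_0_iff)
  show "n + int (degree p) = m + int (degree r)"
  proof (cases "m \<le> n")
    case False
    then show ?thesis using *[of m r n p] assms(1) r by simp
  qed (use * assms in blast)
qed

section \<open>The gluing conditions and the numerator of the wave function\<close>

locale double_points = q_shift q for q :: real +
  fixes g :: nat and lam mu \<delta> :: "nat \<Rightarrow> complex" and k :: "nat \<Rightarrow> nat"
  assumes lam_neq_0: "\<And>i. i < g \<Longrightarrow> lam i \<noteq> 0" and mu_neq_0: "\<And>i. i < g \<Longrightarrow> mu i \<noteq> 0"
    and inj_lam: "inj_on lam {..<g}" and inj_mu: "inj_on mu {..<g}"
    and lam_mu_disjoint: "lam ` {..<g} \<inter> mu ` {..<g} = {}"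
    and k_pos: "\<And>i. i < g \<Longrightarrow> k i > 0"
    and lam_eq: "\<And>i. i < g \<Longrightarrow> lam i = Q ^ k i * mu i"
    and delta_neq_0: "\<And>i. i < g \<Longrightarrow> \<delta> i \<noteq> 0"
    and den_neq_0: "\<And>n. wave_den g lam mu \<delta> n \<noteq> 0"
begin

abbreviation V where "V \<equiv> curve_flag g lam mu \<delta>"
abbreviation \<Psi> where "\<Psi> \<equiv> wave g lam mu \<delta>"
abbreviation Lam :: ratfun where "Lam \<equiv> \<Prod>i<g. Z - const (lam i)"

text \<open>The gluing conditions on f = z^n p, written in terms of p, so that \<open>V n\<close> is
  parametrized by polynomials.\<close>

definition glued :: "int \<Rightarrow> complex poly \<Rightarrow> bool" where
  "glued n p \<longleftrightarrow>
    (\<forall>i<g. lam i powi n * poly p (lam i) = \<delta> i * (mu i powi n * poly p (mu i)))"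

lemma glued_add: "glued n p \<Longrightarrow> glued n r \<Longrightarrow> glued n (p + r)"
  by (simp add: glued_def algebra_simps)

lemma glued_smult: "glued n p \<Longrightarrow> glued n (Polynomial.smult c p)"
  by (simp add: glued_def mult.left_commute)

lemma glued_diff: "glued n p \<Longrightarrow> glued n r \<Longrightarrow> glued n (p - r)"
  by (simp add: glued_def algebra_simps)

lemma glued_monom_mult: "glued (n + int j) p \<Longrightarrow> glued n (Polynomial.monom 1 j * p)"
  using lam_neq_0 mu_neq_0 by (simp add: glued_def poly_monom power_int_add mult.assoc)

lemma mem_V_iff: "v \<in> V n \<longleftrightarrow> (\<exists>p. v = Z powi n * to_fract p / Lam \<and> glued n p)"
proof -
  have "(\<forall>i<g. rf_eval (Z powi n * to_fract p) (lam i) = \<delta> i * rf_eval (Z powi n * to_fract p) (mu i))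
      \<longleftrightarrow> glued n p" for p
    by (simp add: glued_def rf_eval_laurent lam_neq_0 mu_neq_0)
  then show ?thesis
    unfolding curve_flag_def zpoly_space_def by (auto simp: divide_inverse mult.commute)
qed

lemma V_subspace: "cvs.subspace (V n)"
proof (rule cvs.subspaceI)
  show "0 \<in> V n"
    unfolding mem_V_iff by (rule exI[of _ 0]) (simp add: glued_def)
next
  fix x y assume "x \<in> V n" "y \<in> V n"
  then obtain p r where "x = Z powi n * to_fract p / Lam" "glued n p"
    "y = Z powi n * to_fract r / Lam" "glued n r" unfolding mem_V_iff by blast
  then show "x + y \<in> V n"
    unfolding mem_V_iff
    by (intro exI[of _ "p + r"]) (simp add: glued_add add_divide_distrib distrib_left)
next
  fix c x assume "x \<in> V n"
  then obtain p where "x = Z powi n * to_fract p / Lam" "glued n p" unfolding mem_V_iff by blast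
  then show "const c * x \<in> V n"
    unfolding mem_V_iff
    by (intro exI[of _ "Polynomial.smult c p"]) (simp add: glued_smult to_fract_smult)
qed

lemma V_antimono_step: "V (n + 1) \<subseteq> V n"
proof
  fix v assume "v \<in> V (n + 1)"
  then obtain p where p: "v = Z powi (n + 1) * to_fract p / Lam" "glued (n + 1) p"
    unfolding mem_V_iff by blast
  have "glued n (Polynomial.monom 1 1 * p)"
    using glued_monom_mult[of n 1 p] p(2) by simp
  moreover have "Z powi (n + 1) * to_fract p = Z powi n * to_fract (Polynomial.monom 1 1 * p)"
    by (subst Z_powi_to_fract_eq_iff) auto
  ultimately show "v \<in> V n" unfolding mem_V_iff p(1) by metis
qed

text \<open>The value of the j-th gluing functional, f(lam_j) - \<delta>_j f(mu_j), at f = z^(n+i).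
  These are the entries of the determinants in the wave function.\<close>

definition gluing :: "int \<Rightarrow> nat \<Rightarrow> nat \<Rightarrow> complex" where
  "gluing n i j = lam j powi (n + int i) - \<delta> j * mu j powi (n + int i)"

lemma gluing_eq: "j < g \<Longrightarrow> gluing n i j = lam j powi n * lam j ^ i - \<delta> j * (mu j powi n * mu j ^ i)"
  by (simp add: gluing_def power_int_add lam_neq_0 mu_neq_0)

lemma glued_iff:
  assumes "degree p \<le> n"
  shows "glued m p \<longleftrightarrow> (\<forall>j<g. (\<Sum>i\<le>n. poly.coeff p i * gluing m i j) = 0)"
proof -
  have poly: "poly p x = (\<Sum>i\<le>n. poly.coeff p i * x ^ i)" for x
    unfolding poly_altdef by (rule sum.mono_neutral_left) (use assms in \<open>auto simp: coeff_eq_0\<close>)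
  have "(\<Sum>i\<le>n. poly.coeff p i * gluing m i j) =
      lam j powi m * poly p (lam j) - \<delta> j * (mu j powi m * poly p (mu j))" if "j < g" for j
    by (simp add: poly gluing_eq[OF that] sum_distrib_left
        right_diff_distrib sum_subtractf mult_ac)
  then show ?thesis by (auto simp: glued_def)
qed

lemma wave_den_eq: "wave_den g lam mu \<delta> n = border_cof g (gluing n) g"
  by (simp add: border_cof_last wave_den_def gluing_def)

text \<open>The g conditions on the g lowest coefficients form a square system with determinant
  \<open>wave_den\<close>, which is nonzero. The degree bound is phrased through coefficients in
  order to cover g = 0, where it forces p = 0.\<close>

lemma glued_low_degree_eq_0:
  assumes "glued m p" and low: "\<And>i. i \<ge> g \<Longrightarrow> poly.coeff p i = 0"
  shows "p = 0"
proof -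
  have "degree p \<le> g" using low by (intro degree_le) auto
  then have "(\<Sum>i\<le>g. poly.coeff p i * gluing m i j) = 0" if "j < g" for j
    using assms(1) that by (simp add: glued_iff)
  then have "(\<Sum>i<g. poly.coeff p i * gluing m i j) = 0" if "j < g" for j
    using that low[of g] by (simp flip: lessThan_Suc_atMost)
  moreover have "det (mat g g (\<lambda>(i, j). gluing m i j)) \<noteq> 0"
    using den_neq_0[of m] by (simp add: wave_den_eq border_cof_last)
  ultimately have "poly.coeff p i = 0" if "i < g" for i
    using kernel_trivial_if_det_neq_0[of g "gluing m" "poly.coeff p"] that by blast
  then show ?thesis using low by (metis leading_coeff_0_iff not_le)
qed

definition pw :: "int \<Rightarrow> complex poly" where
  "pw n = (\<Sum>i\<le>g. Polynomial.monom (border_cof g (gluing n) i / wave_den g lam mu \<delta> n) i)"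

lemma coeff_pw:
  "poly.coeff (pw n) i = (if i \<le> g then border_cof g (gluing n) i / wave_den g lam mu \<delta> n else 0)"
  by (simp add: pw_def coeff_sum)

lemma coeff_pw_top [simp]: "poly.coeff (pw n) g = 1"
  using den_neq_0[of n] by (simp add: coeff_pw wave_den_eq)

lemma degree_pw: "degree (pw n) = g"
proof (rule antisym)
  show "degree (pw n) \<le> g" by (rule degree_le) (simp add: coeff_pw)
  show "g \<le> degree (pw n)" by (rule le_degree) simp
qed

lemma pw_neq_0: "pw n \<noteq> 0"
  using coeff_pw_top[of n] by fastforce

lemma glued_pw: "glued n (pw n)"
  unfolding glued_iff[OF eq_refl[OF degree_pw]]
proof (intro allI impI)
  fix j assume "j < g"
  then show "(\<Sum>i\<le>g. poly.coeff (pw n) i * gluing n i j) = 0"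
    using border_cof_orthogonal[of j g "gluing n"]
    by (simp add: coeff_pw mult.commute flip: sum_divide_distrib)
qed

lemma wave_eq: "\<Psi> n = Z powi n * to_fract (pw n) / Lam"
proof -
  have "wave_num g lam mu \<delta> n =
      det (mat (g + 1) (g + 1) (\<lambda>(i, j). if j < g then const (gluing n i j) else Z powi (n + int i)))"
    unfolding wave_num_def gluing_def by (rule arg_cong[of _ _ det], rule eq_matI) auto
  also have "\<dots> = (\<Sum>i\<le>g. Z powi (n + int i) * const (border_cof g (gluing n) i))"
    by (simp only: det_border border_cof_const)
  finally have "wave_num g lam mu \<delta> n / const (wave_den g lam mu \<delta> n) =
      (\<Sum>i\<le>g. Z powi n * (const (border_cof g (gluing n) i / wave_den g lam mu \<delta> n) * Z ^ i))"
    by (simp add: sum_divide_distrib const_divide power_int_add mult_ac)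
  also have "\<dots> = Z powi n * to_fract (pw n)"
    by (simp add: to_fract_conv_sum[OF eq_refl[OF degree_pw]] coeff_pw sum_distrib_left)
  finally show ?thesis by (simp add: wave_def divide_inverse mult.commute)
qed

lemma wave_neq_0: "\<Psi> n \<noteq> 0"
  by (simp add: wave_eq pw_neq_0 power_int_eq_0_iff)

lemma wave_in_V: "\<Psi> n \<in> V n"
  unfolding mem_V_iff using wave_eq glued_pw by blast

text \<open>The numerator over z^m / \<open>Lam\<close>-scaling of a combination of
  \<open>\<Psi> m\<close>, \<open>\<Psi> (m + 1)\<close>, and so on; see \<open>comb_wave\<close>.
  The j-th summand has degree j + g and leading coefficient \<open>c j\<close>, so the expansion is
  triangular.\<close>

definition comb :: "int \<Rightarrow> (nat \<Rightarrow> complex) \<Rightarrow> nat \<Rightarrow> complex poly" where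
  "comb m c N = (\<Sum>j<N. Polynomial.smult (c j) (Polynomial.monom 1 j * pw (m + int j)))"

lemma comb_Suc:
  "comb m c (Suc N) = comb m c N + Polynomial.smult (c N) (Polynomial.monom 1 N * pw (m + int N))"
  by (simp add: comb_def)

lemma coeff_shift_pw:
  "poly.coeff (Polynomial.monom 1 N * pw n) i =
    (if i < N then 0 else poly.coeff (pw n) (i - N))"
  by (simp add: coeff_monom_mult)

lemma coeff_comb_high:
  assumes "\<And>j. M \<le> j \<Longrightarrow> j < N \<Longrightarrow> c j = 0" "i \<ge> M + g"
  shows "poly.coeff (comb m c N) i = 0"
proof -
  have "c j * poly.coeff (Polynomial.monom 1 j * pw (m + int j)) i = 0" if "j < N" for j
  proof (cases "M \<le> j")
    case False
    then have "i - j > g" using assms(2) by simp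
    then show ?thesis by (simp add: coeff_shift_pw coeff_pw)
  qed (use assms(1) that in simp)
  then show ?thesis
    unfolding comb_def coeff_sum by (intro sum.neutral) (simp del: mult_eq_0_iff)
qed

text \<open>By triangularity the coefficients are read off from the top downwards. With M = 0 this
  gives uniqueness of a difference operator with prescribed action on \<open>\<Psi>\<close>; with a
  larger M it bounds its order.\<close>

lemma comb_coeffs_eq_0:
  assumes "\<And>i. i \<ge> M + g \<Longrightarrow> poly.coeff (comb m c N) i = 0" "M \<le> j" "j < N"
  shows "c j = 0"
  using assms
proof (induction N arbitrary: j)
  case (Suc N)
  have "M \<le> N" using Suc.prems by simp
  have "poly.coeff (comb m c (Suc N)) (N + g) = c N"
    using coeff_comb_high[of N N c "N + g" m] by (simp add: comb_Suc coeff_shift_pw)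
  then have "c N = 0" using Suc.prems(1)[of "N + g"] \<open>M \<le> N\<close> by simp
  moreover from this have "comb m c (Suc N) = comb m c N" by (simp add: comb_Suc)
  ultimately show ?case
    using Suc.IH[of j] Suc.prems by (metis less_Suc_eq)
qed simp

lemma exists_comb:
  assumes "glued m p" "\<And>i. i \<ge> N + g \<Longrightarrow> poly.coeff p i = 0"
  shows "\<exists>c. p = comb m c N"
  using assms
proof (induction N arbitrary: p)
  case 0
  then show ?case using glued_low_degree_eq_0[of m p] by (simp add: comb_def)
next
  case (Suc N)
  \<comment> \<open>The polynomial \<open>pw (m + int N)\<close> satisfies the conditions of level m
    + N; the factor z^N brings it back to level m.\<close>
  let ?t = "Polynomial.smult (poly.coeff p (N + g)) (Polynomial.monom 1 N * pw (m + int N))"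
  have "glued m (p - ?t)"
    by (intro glued_diff glued_smult glued_monom_mult glued_pw Suc.prems(1))
  moreover have "poly.coeff (p - ?t) i = 0" if "i \<ge> N + g" for i
  proof (cases "i = N + g")
    case False
    then have "i \<ge> Suc N + g" using that by simp
    then show ?thesis using Suc.prems(2)[of i] by (simp add: coeff_shift_pw coeff_pw)
  qed (simp add: coeff_shift_pw)
  ultimately obtain c where c: "p - ?t = comb m c N" using Suc.IH by blast
  define c' where "c' = c(N := poly.coeff p (N + g))"
  have "comb m c' N = comb m c N" by (simp add: comb_def c'_def)
  then have "comb m c' (Suc N) = p"
    using c by (simp add: comb_Suc c'_def algebra_simps)
  then show ?case by metis
qed

lemma comb_wave:
  "(\<Sum>j<N. const (c j) * \<Psi> (m + int j)) = Z powi m * to_fract (comb m c N) / Lam"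
proof -
  have "const (c j) * \<Psi> (m + int j) =
      Z powi m * to_fract (Polynomial.smult (c j) (Polynomial.monom 1 j * pw (m + int j))) / Lam" for j
    by (simp add: wave_eq to_fract_smult to_fract_monom const_1 power_int_add mult_ac)
  then show ?thesis
    by (simp add: comb_def sum_distrib_left sum_divide_distrib)
qed

section \<open>Uniqueness, order and existence of the difference operators\<close>

lemma diff_op_window:
  assumes "{j. h j \<noteq> 0} \<subseteq> {l..<l + int N}"
  shows "diff_op h \<phi> n = (\<Sum>j<N. const (h (l + int j) n) * \<phi> (n + l + int j))"
proof -
  have "diff_op h \<phi> n = (\<Sum>j\<in>{l..<l + int N}. const (h j n) * \<phi> (n + j))"
    unfolding diff_op_def by (rule sum.mono_neutral_left) (use assms in auto)
  also have "\<dots> = (\<Sum>j<N. const (h (l + int j) n) * \<phi> (n + l + int j))"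
    by (rule sum.reindex_bij_witness[of _ "\<lambda>j. l + int j" "\<lambda>j. nat (j - l)"]) auto
  finally show ?thesis .
qed

lemma diff_op_wave:
  assumes "{j. h j \<noteq> 0} \<subseteq> {l..<l + int N}"
  shows "diff_op h \<Psi> n = Z powi (n + l) * to_fract (comb (n + l) (\<lambda>j. h (l + int j) n) N) / Lam"
  unfolding diff_op_window[OF assms] using comb_wave[of "\<lambda>j. h (l + int j) n" "n + l" N] by simp

lemma exists_window:
  assumes "finite S"
  shows "\<exists>l N. l \<le> d \<and> d < l + int N \<and> S \<subseteq> {l..<l + int N}"
proof -
  define b where "b = Max (abs ` insert d S)"
  have "\<bar>x\<bar> \<le> b" if "x \<in> insert d S" for x
    unfolding b_def using assms that by (intro Max_ge) auto
  then show ?thesis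
    by (intro exI[of _ "- b"] exI[of _ "nat (2 * b + 1)"]) force
qed

lemma diff_op_wave_eq_0:
  assumes fin: "finite {j. h j \<noteq> 0}" and "diff_op h \<Psi> = (\<lambda>n. 0)"
  shows "h j = 0"
proof (rule ext)
  fix n
  obtain l N where w: "l \<le> j" "j < l + int N" "{j. h j \<noteq> 0} \<subseteq> {l..<l + int N}"
    using exists_window[OF fin] by blast
  have "comb (n + l) (\<lambda>j. h (l + int j) n) N = 0"
    using diff_op_wave[OF w(3), of n] assms(2) by (simp add: power_int_eq_0_iff)
  then have "h (l + int (nat (j - l))) n = 0"
    using w by (intro comb_coeffs_eq_0[where c = "\<lambda>j. h (l + int j) n" and M = 0 and m = "n + l" and N = N]) auto
  then show "h j n = 0 n" using w(1) by simp
qed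

text \<open>The order of the operator is the growth of its eigenvalue at infinity: each
  \<open>pw n\<close> has the same degree g, so the degree of the combination tells the position of
  its last nonzero coefficient. That coefficient is nonzero for every n.\<close>

lemma diff_op_wave_order:
  assumes fin: "finite {j. h j \<noteq> 0}" and eq: "diff_op h \<Psi> = (\<lambda>n. Z powi e * to_fract p * \<Psi> n)"
    and p: "p \<noteq> 0"
  shows "diff_has_order (diff_op h) (e + int (degree p))"
proof -
  define d where "d = e + int (degree p)"
  obtain l N where w: "l \<le> d" "d < l + int N" "{j. h j \<noteq> 0} \<subseteq> {l..<l + int N}"
    using exists_window[OF fin] by blast
  let ?C = "\<lambda>n. comb (n + l) (\<lambda>j. h (l + int j) n) N"
  have C: "?C n \<noteq> 0" "int (degree (?C n)) = d - l + int g" for n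
  proof -
    have "Z powi (n + e) * to_fract (p * pw n) = Z powi (n + l) * to_fract (?C n)"
      using diff_op_wave[OF w(3), of n] eq by (simp add: wave_eq power_int_add mult_ac)
    note * = Z_powi_to_fract_eq_degree[OF this]
    show "?C n \<noteq> 0" using *(2) p pw_neq_0 by simp
    show "int (degree (?C n)) = d - l + int g"
      using *(1) p pw_neq_0 by (simp add: degree_mult_eq degree_pw d_def)
  qed
  have zero: "h j n = 0" if "j > d" for j n
  proof (cases "j < l + int N")
    case True
    have "h (l + int (nat (j - l))) n = 0"
    proof (rule comb_coeffs_eq_0[where c = "\<lambda>j. h (l + int j) n"])
      show "poly.coeff (?C n) i = 0" if "i \<ge> Suc (nat (d - l)) + g" for i
        using that C(2)[of n] w(1) by (intro coeff_eq_0) linarith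
    qed (use True that w(1) in auto)
    then show ?thesis using that w(1) by simp
  next
    case False
    then have "h j = 0" using w(3) by fastforce
    then show ?thesis by simp
  qed
  have "h d n \<noteq> 0" for n
  proof
    assume hd: "h d n = 0"
    have "poly.coeff (?C n) (nat (d - l) + g) = 0"
    proof (rule coeff_comb_high[where M = "nat (d - l)"])
      fix j assume "nat (d - l) \<le> j"
      then have "d \<le> l + int j" by linarith
      then show "h (l + int j) n = 0" using hd zero by (cases "d = l + int j") auto
    qed simp
    moreover have "nat (d - l) + g = degree (?C n)" using C(2)[of n] w(1) by linarith
    ultimately show False using C(1)[of n] by simp
  qed
  then have "h d \<noteq> 0" by auto
  moreover have "\<forall>j>d. h j = 0" using zero by (auto simp: fun_eq_iff)
  ultimately show ?thesis unfolding diff_has_order_def d_def using fin by blast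
qed

lemma exists_diff_op:
  assumes f: "f \<in> flag_ring V"
  shows "\<exists>P\<in>diff_ops. P \<Psi> = (\<lambda>n. f * \<Psi> n)"
proof -
  obtain l where l: "\<And>n v. v \<in> V n \<Longrightarrow> f * v \<in> V (n + l)"
    using flag_ring_shift[of f V] f by blast
  obtain e p where p: "f = Z powi e * to_fract p"
    using f unfolding flag_ring_def laurent_iff by blast
  \<comment> \<open>The numerator of f \<open>\<Psi> n\<close> relative to level n + l has degree
    degree p + e - l + g when p is nonzero. This bound is independent of n, so finitely many shifts
    serve all n.\<close>
  define N where "N = Suc (nat (int (degree p) + e - l))"
  have "\<exists>c. f * \<Psi> n = Z powi (n + l) * to_fract (comb (n + l) c N) / Lam" for n
  proof -
    obtain r where r: "f * \<Psi> n = Z powi (n + l) * to_fract r / Lam" "glued (n + l) r"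
      using l[OF wave_in_V] unfolding mem_V_iff by blast
    have eq: "Z powi (n + e) * to_fract (p * pw n) = Z powi (n + l) * to_fract r"
      using r(1) by (simp add: p wave_eq power_int_add mult_ac)
    have "poly.coeff r i = 0" if "i \<ge> N + g" for i
    proof (cases "p = 0")
      case True
      then show ?thesis using eq by (simp add: power_int_eq_0_iff)
    next
      case False
      then have "n + e + int (degree p + g) = n + l + int (degree r)"
        using Z_powi_to_fract_eq_degree(1)[OF eq] pw_neq_0
        by (simp add: degree_mult_eq degree_pw)
      then show ?thesis using that unfolding N_def by (intro coeff_eq_0) linarith
    qed
    then show ?thesis using exists_comb[OF r(2)] r(1) by metis
  qed
  then obtain c where c: "f * \<Psi> n = Z powi (n + l) * to_fract (comb (n + l) (c n) N) / Lam" for n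
    by metis
  define h where "h j n = (if l \<le> j \<and> j < l + int N then c n (nat (j - l)) else 0)" for j n
  have supp: "{j. h j \<noteq> 0} \<subseteq> {l..<l + int N}"
    by (auto simp: h_def fun_eq_iff split: if_splits)
  have "comb (n + l) (\<lambda>j. h (l + int j) n) N = comb (n + l) (c n) N" for n
    by (simp add: comb_def h_def)
  then have "diff_op h \<Psi> = (\<lambda>n. f * \<Psi> n)"
    by (simp add: fun_eq_iff diff_op_wave[OF supp] c)
  moreover have "finite {j. h j \<noteq> 0}" by (rule finite_subset[OF supp]) simp
  ultimately show ?thesis unfolding diff_ops_def by blast
qed

text \<open>It vanishes at all nodes, so any product with it satisfies the gluing conditions with
  both sides 0. This places it, times any power of z, in \<open>flag_ring V\<close>.\<close>

definition node_poly :: "complex poly" where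
  "node_poly = (\<Prod>i<g. [:- lam i, 1:]) * (\<Prod>i<g. [:- mu i, 1:])"

lemma degree_node_poly: "degree node_poly = 2 * g" "node_poly \<noteq> 0"
proof -
  show "node_poly \<noteq> 0" by (simp add: node_poly_def)
  have "degree (\<Prod>i<g. [:- c i, 1:]) = g" for c :: "nat \<Rightarrow> complex"
    by (subst degree_prod_eq_sum_degree) auto
  then show "degree node_poly = 2 * g"
    unfolding node_poly_def by (subst degree_mult_eq) auto
qed

lemma node_poly_in_flag_ring: "Z powi e * to_fract node_poly \<in> flag_ring V"
proof -
  have zero: "poly node_poly (lam i) = 0" "poly node_poly (mu i) = 0" if "i < g" for i
    using that by (auto simp: node_poly_def poly_prod)
  have "Z powi e * to_fract node_poly * v \<in> V (n + e)" if v: "v \<in> V n" for n v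
  proof -
    obtain p where "v = Z powi n * to_fract p / Lam"
      using v unfolding mem_V_iff by blast
    then show ?thesis
      unfolding mem_V_iff
      by (intro exI[of _ "node_poly * p"]) (simp add: power_int_add glued_def zero mult_ac)
  qed
  then show ?thesis unfolding flag_ring_def laurent_iff by blast
qed

lemma difference_side:
  "\<exists>L. L ` flag_ring V \<subseteq> diff_ops
      \<and> cring (op_ring (L ` flag_ring V))
      \<and> L \<in> ring_iso (func_ring (flag_ring V)) (op_ring (L ` flag_ring V))
      \<and> diff_rank (L ` flag_ring V) = 1
      \<and> (\<forall>f\<in>flag_ring V. L f \<Psi> = (\<lambda>n. f * \<Psi> n))"
proof -
  define rep where "rep f P \<longleftrightarrow> P \<in> diff_ops \<and> P \<Psi> = (\<lambda>n. f * \<Psi> n)" for f P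
  note closed = flag_ring_closed[of V, OF V_subspace V_antimono_step]
  have ex: "\<exists>P. rep f P" if "f \<in> flag_ring V" for f
    using exists_diff_op[OF that] unfolding rep_def by blast
  have rep_0: "rep 0 (\<lambda>x. 0)"
    using dop.zero_in_ops by (simp add: rep_def dop_ops_eq fun_eq_iff)
  have rep_1: "rep 1 id"
    using dop.id_in_ops by (simp add: rep_def dop_ops_eq)
  have rep_add: "rep (f + h) (\<lambda>x. P x + R x)" if "rep f P" "rep h R" for f h P R
    using that dop.add_in_ops[of P R] by (simp add: rep_def dop_ops_eq fun_eq_iff distrib_right)
  have rep_mult: "rep (f * h) (P \<circ> R)" if fP: "rep f P" and hR: "rep h R" for f h P R
  proof -
    obtain H where H: "P = diff_op H" using fP unfolding rep_def diff_ops_def by blast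
    have "P (\<lambda>n. h * \<Psi> n) = (\<lambda>n. h * P \<Psi> n)" unfolding H by (rule diff_op_mult)
    moreover have "R \<Psi> = (\<lambda>n. h * \<Psi> n)" "P \<Psi> = (\<lambda>n. f * \<Psi> n)"
      using fP hR by (simp_all add: rep_def)
    moreover have "P \<circ> R \<in> diff_ops"
      using fP hR dop.comp_in_ops[of P R] unfolding rep_def dop_ops_eq by blast
    ultimately show ?thesis by (simp add: rep_def mult.assoc mult.left_commute)
  qed
  have rep_unique: "P = R" if P: "rep f P" and R: "rep f R" for f P R
  proof -
    obtain H where H: "P = dop.op H" "finite {j. H j \<noteq> 0}"
      using P unfolding rep_def dop_ops_eq[symmetric] dop.ops_def by blast
    obtain K where K: "R = dop.op K" "finite {j. K j \<noteq> 0}"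
      using R unfolding rep_def dop_ops_eq[symmetric] dop.ops_def by blast
    define D where "D j = H j - K j" for j
    have fin: "finite {j. D j \<noteq> 0}"
      by (rule finite_subset[of _ "{j. H j \<noteq> 0} \<union> {j. K j \<noteq> 0}"]) (use H K in \<open>auto simp: D_def\<close>)
    have PDR: "P x = dop.op D x + R x" for x
    proof -
      have "(\<lambda>j. D j + K j) = H" by (simp add: D_def)
      then show ?thesis using dop.op_add[OF fin K(2), of x] by (simp add: H(1) K(1))
    qed
    have "diff_op D \<Psi> = (\<lambda>n. 0)"
      using PDR[of \<Psi>] P R by (simp add: rep_def dop_op_eq fun_eq_iff)
    then have "D j = 0" for j by (rule diff_op_wave_eq_0[OF fin])
    then have "dop.op D x = 0" for x by (simp add: dop.op_def)
    then show "P = R" using PDR by (simp add: fun_eq_iff)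
  qed
  have rep_inj: "f = h" if "rep f P" "rep h P" for f h P
    using that wave_neq_0[of 0] unfolding rep_def by (metis mult_right_cancel)
  obtain L where L: "\<And>f. f \<in> flag_ring V \<Longrightarrow> rep f (L f)" "cring (op_ring (L ` flag_ring V))"
      "L \<in> ring_iso (func_ring (flag_ring V)) (op_ring (L ` flag_ring V))"
    by (rule operator_ring_iso[of "flag_ring V" rep])
      (assumption | rule closed ex rep_0 rep_1 rep_add rep_mult rep_unique rep_inj | blast)+
  \<comment> \<open>The exponent compensates the degree 2g of \<open>node_poly\<close>, so that the
    order is 1.\<close>
  let ?f = "Z powi (1 - 2 * int g) * to_fract node_poly"
  have f: "?f \<in> flag_ring V" by (rule node_poly_in_flag_ring)
  obtain h where h: "L ?f = diff_op h" "finite {j. h j \<noteq> 0}"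
    using L(1)[OF f] unfolding rep_def diff_ops_def by blast
  have "diff_has_order (L ?f) 1"
    using diff_op_wave_order[OF h(2), of "1 - 2 * int g" node_poly] L(1)[OF f]
    by (simp add: h(1) rep_def degree_node_poly)
  then have "(1::int) \<in> {d. \<exists>P\<in>L ` flag_ring V. diff_has_order P d}" using f by blast
  then have "diff_rank (L ` flag_ring V) = 1"
    unfolding diff_rank_def by (intro Gcd_eq_1_I[of 1]) simp_all
  then show ?thesis using L unfolding rep_def by blast
qed

end

section \<open>Rational flags of Laurent polynomials constant modulo a polynomial\<close>

lemma not_pole_obtain:
  assumes "\<not> pole_at f a"
  obtains u v where "f = Fract u v" "poly v a \<noteq> 0"
  using assms Fract_quot_of_fract[of f] unfolding pole_at_def by metis

lemma rf_eval_add: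
  assumes "\<not> pole_at f a" "\<not> pole_at h a"
  shows "rf_eval (f + h) a = rf_eval f a + rf_eval h a" "\<not> pole_at (f + h) a"
proof -
  obtain u v where f: "f = Fract u v" "poly v a \<noteq> 0" using assms(1) by (rule not_pole_obtain)
  obtain x y where h: "h = Fract x y" "poly y a \<noteq> 0" using assms(2) by (rule not_pole_obtain)
  have "v \<noteq> 0" "y \<noteq> 0" using f h by auto
  then have eq: "f + h = Fract (u * y + x * v) (v * y)" using f h by simp
  have "rf_eval (f + h) a = (poly u a * poly y a + poly x a * poly v a) / (poly v a * poly y a)"
    unfolding eq using f(2) h(2) by (subst rf_eval_Fract(2)) simp_all
  also have "\<dots> = poly u a / poly v a + poly x a / poly y a"
    using f(2) h(2) by (simp add: add_frac_eq)
  also have "\<dots> = rf_eval f a + rf_eval h a"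
    unfolding f(1) h(1) using f(2) h(2) by (simp add: rf_eval_Fract(2))
  finally show "rf_eval (f + h) a = rf_eval f a + rf_eval h a" .
  show "\<not> pole_at (f + h) a"
    unfolding eq by (rule rf_eval_Fract(1)) (use f(2) h(2) in simp)
qed

lemma rf_eval_mult:
  assumes "\<not> pole_at f a" "\<not> pole_at h a"
  shows "rf_eval (f * h) a = rf_eval f a * rf_eval h a" "\<not> pole_at (f * h) a"
proof -
  obtain u v where f: "f = Fract u v" "poly v a \<noteq> 0" using assms(1) by (rule not_pole_obtain)
  obtain x y where h: "h = Fract x y" "poly y a \<noteq> 0" using assms(2) by (rule not_pole_obtain)
  have eq: "f * h = Fract (u * x) (v * y)" using f h by simp
  have "rf_eval (f * h) a = (poly u a * poly x a) / (poly v a * poly y a)"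
    unfolding eq using f(2) h(2) by (subst rf_eval_Fract(2)) simp_all
  also have "\<dots> = poly u a / poly v a * poly x a / poly y a"
    using f(2) h(2) by (simp add: add_frac_eq)
  also have "\<dots> = rf_eval f a * rf_eval h a"
    unfolding f(1) h(1) using f(2) h(2) by (simp add: rf_eval_Fract(2))
  finally show "rf_eval (f * h) a = rf_eval f a * rf_eval h a" .
  show "\<not> pole_at (f * h) a"
    unfolding eq by (rule rf_eval_Fract(1)) (use f(2) h(2) in simp)
qed

lemma rf_eval_const: "rf_eval (const c) a = c" "\<not> pole_at (const c) a"
  using rf_eval_Fract[of 1 a "[:c:]"] by (simp_all add: const_def Fract_conv_to_fract)

lemma not_pole_laurent: "a \<noteq> 0 \<Longrightarrow> \<not> pole_at (Z powi e * to_fract p) a"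
  using laurent_iff by blast

text \<open>A polynomial that does not vanish at 0 is coprime to z. One factor z is cancelled at a
  time, after evaluation at 0 shows that it divides the cofactor.\<close>

lemma dvd_cancel_X_power:
  fixes s p :: "'a::field poly"
  assumes s: "poly s 0 \<noteq> 0" and dvd: "s dvd Polynomial.monom 1 n * p"
  shows "s dvd p"
  using dvd
proof (induction n)
  case (Suc n)
  obtain u where u: "Polynomial.monom 1 (Suc n) * p = s * u" using Suc.prems by (elim dvdE)
  have "poly s 0 * poly u 0 = 0"
    using arg_cong[OF u, of "\<lambda>p. poly p 0"] by (simp add: poly_monom)
  then have "[:- 0, 1:] dvd u" using s by (simp only: poly_eq_0_iff_dvd[symmetric]) simp
  then obtain w where w: "u = [:0, 1:] * w" by (auto elim: dvdE)
  have "[:0, 1:] * (Polynomial.monom 1 n * p) = [:0, 1:] * (s * w)"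
    using u by (simp add: w monom_Suc mult_ac)
  then have "Polynomial.monom 1 n * p = s * w"
    by (subst (asm) mult_cancel_left) auto
  then show ?case using Suc.IH by (metis dvd_triv_left)
qed (use assms in simp)

definition const_mod :: "complex poly \<Rightarrow> ratfun set" where
  "const_mod s = {const c + to_fract s * (Z powi e * to_fract l) |c e l. True}"

text \<open>\<open>const_mod s\<close> is the ring of functions on the curve obtained from the
  punctured line by collapsing the zero scheme of \<open>s\<close> to one point. The shift by degree
  s - 1 fits the definition of a rational flag with r = z^(degree s - 1): the codimension is then
  exactly degree r.\<close>

definition const_mod_flag :: "complex poly \<Rightarrow> int \<Rightarrow> ratfun set" where
  "const_mod_flag s n = const_mod s \<inter> zpoly_space (n - int (degree s - 1)) 1"

lemma mem_const_modI: "f = const c + to_fract s * (Z powi e * to_fract l) \<Longrightarrow> f \<in> const_mod s"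
  unfolding const_mod_def by blast

lemma mem_zpoly_space_1: "f \<in> zpoly_space n 1 \<longleftrightarrow> (\<exists>p. f = Z powi n * to_fract p)"
  by (auto simp: zpoly_space_def)

lemma subspace_zpoly_space_1: "cvs.subspace (zpoly_space n 1)"
proof (rule cvs.subspaceI)
  show "0 \<in> zpoly_space n 1"
    unfolding mem_zpoly_space_1 by (rule exI[of _ 0]) simp
next
  fix x y assume "x \<in> zpoly_space n 1" "y \<in> zpoly_space n 1"
  then show "x + y \<in> zpoly_space n 1"
    unfolding mem_zpoly_space_1 by (metis distrib_left to_fract_add)
next
  fix c x assume "x \<in> zpoly_space n 1"
  then show "const c * x \<in> zpoly_space n 1"
    unfolding mem_zpoly_space_1 by (metis mult.left_commute to_fract_smult)
qed

lemma subspace_const_mod: "cvs.subspace (const_mod s)"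
proof (rule cvs.subspaceI)
  show "0 \<in> const_mod s"
    by (rule mem_const_modI[of _ 0 _ 0 0]) simp
next
  fix x y assume "x \<in> const_mod s" "y \<in> const_mod s"
  then obtain c e l c' e' l' where
    x: "x = const c + to_fract s * (Z powi e * to_fract l)" and
    y: "y = const c' + to_fract s * (Z powi e' * to_fract l')"
    unfolding const_mod_def by blast
  obtain e'' l'' where eq:
    "Z powi e * to_fract l + Z powi e' * to_fract l' = Z powi e'' * to_fract l''"
    using laurent_add by blast
  have "x + y = (const c + const c') +
      to_fract s * (Z powi e * to_fract l + Z powi e' * to_fract l')"
    unfolding x y by (simp only: distrib_left add_ac)
  then have "x + y = const (c + c') + to_fract s * (Z powi e'' * to_fract l'')"
    by (simp only: eq const_add)
  then show "x + y \<in> const_mod s" by (rule mem_const_modI)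
next
  fix b x assume "x \<in> const_mod s"
  then obtain c e l where x: "x = const c + to_fract s * (Z powi e * to_fract l)"
    unfolding const_mod_def by blast
  have "const b * x = const (b * c) + to_fract s * (Z powi e * to_fract (Polynomial.smult b l))"
    by (simp add: x const_mult to_fract_smult algebra_simps)
  then show "const b * x \<in> const_mod s" by (rule mem_const_modI)
qed

lemma subspace_const_mod_flag: "cvs.subspace (const_mod_flag s n)"
  unfolding const_mod_flag_def by (intro cvs.subspace_inter subspace_const_mod subspace_zpoly_space_1)

lemma zpoly_space_mono:
  assumes "m \<le> n" shows "zpoly_space n 1 \<subseteq> zpoly_space m 1"
proof
  fix f assume "f \<in> zpoly_space n 1"
  then obtain p where "f = Z powi n * to_fract p" unfolding mem_zpoly_space_1 by blast
  then have "f = Z powi m * to_fract (Polynomial.monom 1 (nat (n - m)) * p)"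
    using Z_powi_to_fract_eq_iff[OF assms] by blast
  then show "f \<in> zpoly_space m 1" unfolding mem_zpoly_space_1 by blast
qed

lemma const_mod_flag_antimono_step: "const_mod_flag s (n + 1) \<subseteq> const_mod_flag s n"
  unfolding const_mod_flag_def
  using zpoly_space_mono[of "n - int (degree s - 1)" "n + 1 - int (degree s - 1)"] by auto

lemma mult_const_mod_flag:
  assumes "v \<in> const_mod_flag s n"
  shows "Z powi e * to_fract s * v \<in> const_mod_flag s (n + e)"
proof -
  obtain p where p: "v = Z powi (n - int (degree s - 1)) * to_fract p"
    using assms unfolding const_mod_flag_def Int_iff mem_zpoly_space_1 by blast
  have "Z powi e * to_fract s * v =
      const 0 + to_fract s * (Z powi (e + (n - int (degree s - 1))) * to_fract p)"
    unfolding p power_int_add[OF disjI1[OF Z_neq_0]] by simp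
  then have "Z powi e * to_fract s * v \<in> const_mod s" by (rule mem_const_modI)
  moreover have "Z powi e * to_fract s * v =
      Z powi (n + e - int (degree s - 1)) * to_fract (s * p)"
  proof -
    have "Z powi (n + e - int (degree s - 1)) = Z powi e * Z powi (n - int (degree s - 1))"
      by (simp flip: power_int_add add: algebra_simps)
    then show ?thesis by (simp add: p)
  qed
  ultimately show ?thesis unfolding const_mod_flag_def Int_iff mem_zpoly_space_1 by blast
qed

lemma Z_powi_s_in_flag_ring: "Z powi e * to_fract s \<in> flag_ring (const_mod_flag s)"
  unfolding flag_ring_def laurent_iff using mult_const_mod_flag by blast

text \<open>The constant 1 lies in the flag at level 0, so f = f * 1 lies in a member of the
  flag.\<close>

lemma flag_ring_subset_const_mod: "flag_ring (const_mod_flag s) \<subseteq> const_mod s"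
proof
  fix f assume f: "f \<in> flag_ring (const_mod_flag s)"
  obtain k where k: "\<And>n v. v \<in> const_mod_flag s n \<Longrightarrow> f * v \<in> const_mod_flag s (n + k)"
    using flag_ring_shift[OF f] by blast
  have "1 \<in> const_mod s" by (rule mem_const_modI[of _ 1 _ 0 0]) (simp add: const_1)
  moreover have "1 \<in> zpoly_space 0 1"
    unfolding mem_zpoly_space_1 by (rule exI[of _ 1]) simp
  then have "1 \<in> zpoly_space (0 - int (degree s - 1)) 1"
    using zpoly_space_mono[of "0 - int (degree s - 1)" 0] by auto
  ultimately have "1 \<in> const_mod_flag s 0" unfolding const_mod_flag_def by blast
  from k[OF this] show "f \<in> const_mod s" unfolding const_mod_flag_def by simp
qed

text \<open>Since s(0) = 1, the polynomial w = (1 - s) / z is an inverse of z modulo s, and w(1) = 1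
  because s(1) = 0. So every space z^m P contains an element congruent to 1 modulo s, even for m >
  0, where it does not contain 1.\<close>

lemma exists_unit_mod:
  fixes s :: "complex poly"
  assumes s0: "poly s 0 = 1" and s1: "poly s 1 = 0"
  shows "\<exists>u l. poly u 1 = 1 \<and> Z powi m * to_fract u = 1 + to_fract s * to_fract l"
proof (cases "m \<le> 0")
  case True
  have "Z powi m * to_fract (Polynomial.monom 1 (nat (- m))) = 1 + to_fract s * to_fract 0"
  proof -
    have "Z powi m * Z ^ nat (- m) = Z powi (m + int (nat (- m)))"
      by (metis Z_neq_0 power_int_add power_int_of_nat)
    then show ?thesis using True by (simp add: to_fract_monom const_1)
  qed
  then show ?thesis by (intro exI[of _ "Polynomial.monom 1 (nat (- m))"] exI[of _ 0]) (simp add: poly_monom)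
next
  case False
  define n where "n = nat m"
  have "poly (1 - s) 0 = 0" using s0 by simp
  then have "[:- 0, 1:] dvd 1 - s" by (simp only: poly_eq_0_iff_dvd)
  then obtain w where w: "1 - s = [:0, 1:] * w" by (auto elim: dvdE)
  have "s dvd (1 - s) ^ n - 1"
    by (subst power_diff_1_eq) simp
  then obtain l where l: "(1 - s) ^ n - 1 = s * l" by (elim dvdE)
  have "poly (1 - s) 1 = 1" using s1 by simp
  then have "poly w 1 = 1" by (simp add: w)
  then have 1: "poly (w ^ n) 1 = 1" by simp
  have "Z powi m * to_fract (w ^ n) = to_fract ((1 - s) ^ n)"
    using False by (simp add: w n_def power_mult_distrib Z_def to_fract_power power_int_def del: mult_pCons_left)
  also have "(1 - s) ^ n = 1 + s * l" using l by (simp add: algebra_simps)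
  finally have "Z powi m * to_fract (w ^ n) = 1 + to_fract s * to_fract l" by simp
  with 1 show ?thesis by blast
qed

text \<open>The complement consists of the z^m (z - 1) t with degree t < d. Such a function vanishes
  at 1, as s does; if it is constant modulo s, the constant is therefore 0, and s, of degree d + 1,
  divides (z - 1) t, so t = 0. For the sum, the constant is removed first, then a remainder modulo s
  that vanishes at 1 is left.\<close>

lemma const_mod_flag_codim:
  fixes s :: "complex poly"
  assumes s0: "poly s 0 = 1" and s1: "poly s 1 = 0"
  defines "d \<equiv> degree s - 1"
  shows "has_codim (const_mod_flag s n) (zpoly_space (n - int d) 1) d"
proof -
  define m where "m = n - int d"
  have s_neq_0: "s \<noteq> 0" using s0 by auto
  have deg: "degree s = Suc d"
  proof -
    have "degree s \<noteq> 0" using s0 s1 by (metis degree_eq_zeroE poly_const_conv zero_neq_one)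
    then show ?thesis by (simp add: d_def)
  qed
  have flag: "const_mod_flag s n = const_mod s \<inter> zpoly_space m 1"
    by (simp add: const_mod_flag_def m_def d_def)
  define e1 :: "complex poly" where "e1 = [:- 1, 1:]"
  have e1: "e1 \<noteq> 0" "poly e1 1 = 0" "degree e1 = 1" by (simp_all add: e1_def)
  define \<phi> where "\<phi> t = Z powi m * to_fract (e1 * t)" for t
  have \<phi>_0: "\<phi> t = 0 \<longleftrightarrow> t = 0" for t
    by (simp add: \<phi>_def power_int_eq_0_iff e1)
  have \<phi>_diff: "\<phi> (t - u) = \<phi> t - \<phi> u" for t u
    by (simp add: \<phi>_def right_diff_distrib)
  have \<phi>_sum: "(\<Sum>i<d. const (v i) * \<phi> (Polynomial.monom 1 i)) = \<phi> (\<Sum>i<d. Polynomial.monom (v i) i)" for v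
    by (simp add: \<phi>_def to_fract_monom sum_distrib_left const_1 mult_ac)
  define b where "b i = \<phi> (Polynomial.monom 1 i)" for i
  have inj: "inj_on b {..<d}"
  proof (rule inj_onI)
    fix i j assume "b i = b j"
    then have "Polynomial.monom (1::complex) i - Polynomial.monom 1 j = 0"
      unfolding b_def by (metis \<phi>_0 \<phi>_diff diff_self)
    then show "i = j" by (simp add: monom_eq_iff')
  qed
  define B where "B = b ` {..<d}"
  have B_sum: "(\<Sum>x\<in>B. const (u x) * x) = \<phi> (\<Sum>i<d. Polynomial.monom (u (b i)) i)" for u
    unfolding B_def by (subst sum.reindex[OF inj]) (simp add: b_def flip: \<phi>_sum)
  have low: "poly.coeff (\<Sum>i<d. Polynomial.monom (v i) i) j = (if j < d then v j else 0)"
    for v :: "nat \<Rightarrow> complex" and j by (simp add: coeff_sum)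
  have fin: "finite B" by (simp add: B_def)
  have span: "cvs.span B = \<phi> ` {t. \<forall>j\<ge>d. poly.coeff t j = 0}"
  proof (intro equalityI subsetI)
    fix x assume "x \<in> cvs.span B"
    then obtain u where "x = (\<Sum>y\<in>B. const (u y) * y)" using cvs.span_finite[OF fin] by auto
    then show "x \<in> \<phi> ` {t. \<forall>j\<ge>d. poly.coeff t j = 0}" by (auto simp: B_sum low)
  next
    fix x assume "x \<in> \<phi> ` {t. \<forall>j\<ge>d. poly.coeff t j = 0}"
    then obtain t where t: "x = \<phi> t" "\<forall>j\<ge>d. poly.coeff t j = 0" by blast
    define u where "u y = poly.coeff t (the_inv_into {..<d} b y)" for y
    have "(\<Sum>i<d. Polynomial.monom (u (b i)) i) = t"
      by (rule poly_eqI) (use t(2) in \<open>auto simp: low u_def the_inv_into_f_f[OF inj]\<close>)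
    then have "x = (\<Sum>y\<in>B. const (u y) * y)" by (simp add: B_sum t(1))
    then show "x \<in> cvs.span B" using cvs.span_finite[OF fin] by auto
  qed
  have indep: "cvs.independent B"
  proof
    assume "cvs.dependent B"
    then obtain u y where u: "y \<in> B" "u y \<noteq> 0" "(\<Sum>x\<in>B. const (u x) * x) = 0"
      using cvs.dependent_finite[OF fin] by auto
    obtain j where j: "j < d" "y = b j" using u(1) by (auto simp: B_def)
    have "(\<Sum>i<d. Polynomial.monom (u (b i)) i) = 0" using u(3) by (simp add: B_sum \<phi>_0)
    then have "u (b j) = 0" using low[of "\<lambda>i. u (b i)" j] j(1) by simp
    then show False using u(2) j(2) by simp
  qed
  have triv: "cvs.span B \<inter> const_mod_flag s n = {0}"
  proof (intro equalityI subsetI)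
    fix x assume x: "x \<in> cvs.span B \<inter> const_mod_flag s n"
    then obtain t where t: "x = \<phi> t" "\<And>j. j \<ge> d \<Longrightarrow> poly.coeff t j = 0" unfolding span by blast
    obtain c e l where c: "x = const c + to_fract s * (Z powi e * to_fract l)"
      using x unfolding flag const_mod_def by blast
    have sl: "to_fract s * (Z powi e * to_fract l) = Z powi e * to_fract (s * l)" by simp
    have "rf_eval x 1 = 0" unfolding t(1) \<phi>_def by (subst rf_eval_laurent) (auto simp: e1)
    moreover have "rf_eval x 1 = c"
      unfolding c sl by (subst rf_eval_add(1))
        (simp_all add: rf_eval_const not_pole_laurent rf_eval_laurent s1 del: to_fract_mult)
    ultimately have "c = 0" by simp
    then have eq: "Z powi m * to_fract (e1 * t) = Z powi e * to_fract (s * l)"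
      using c unfolding sl t(1) \<phi>_def by simp
    have dvd: "s dvd e1 * t"
    proof (cases "e \<le> m")
      case True
      then have "Polynomial.monom 1 (nat (m - e)) * (e1 * t) = s * l"
        using Z_powi_to_fract_eq_iff[of e m "e1 * t" "s * l"] eq by blast
      then have "s dvd Polynomial.monom 1 (nat (m - e)) * (e1 * t)" by (metis dvd_triv_left)
      then show ?thesis by (rule dvd_cancel_X_power[rotated]) (simp add: s0)
    next
      case False
      then have "Polynomial.monom 1 (nat (e - m)) * (s * l) = e1 * t"
        using Z_powi_to_fract_eq_iff[of m e "s * l" "e1 * t"] eq by simp
      then show ?thesis by (metis dvd_triv_left mult.left_commute)
    qed
    have "t = 0"
    proof (rule ccontr)
      assume t0: "t \<noteq> 0"
      then have "degree s \<le> degree (e1 * t)"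
        by (intro dvd_imp_degree_le dvd) (simp add: e1)
      also have "\<dots> = Suc (degree t)" using t0 by (subst degree_mult_eq) (auto simp: e1)
      also have "\<dots> \<le> d"
        using t(2) t0 by (metis Suc_leI leading_coeff_0_iff not_le)
      finally show False using deg by simp
    qed
    then show "x \<in> {0}" by (simp add: t(1) \<phi>_0)
  next
    fix x :: ratfun assume "x \<in> {0}"
    then show "x \<in> cvs.span B \<inter> const_mod_flag s n"
      using cvs.subspace_0[OF subspace_const_mod_flag] cvs.span_zero by auto
  qed
  have sub: "cvs.span B \<subseteq> zpoly_space m 1"
    unfolding span \<phi>_def zpoly_space_def by (auto simp del: to_fract_mult)
  have "{u + v |u v. u \<in> cvs.span B \<and> v \<in> const_mod_flag s n} = zpoly_space m 1"
  proof (intro equalityI subsetI)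
    fix x assume "x \<in> {u + v |u v. u \<in> cvs.span B \<and> v \<in> const_mod_flag s n}"
    then show "x \<in> zpoly_space m 1"
      using sub cvs.subspace_add[OF subspace_zpoly_space_1] unfolding flag by blast
  next
    fix x assume "x \<in> zpoly_space m 1"
    then obtain p where p: "x = Z powi m * to_fract p" unfolding mem_zpoly_space_1 by blast
    obtain u l where u: "poly u 1 = 1" "Z powi m * to_fract u = 1 + to_fract s * to_fract l"
      using exists_unit_mod[OF s0 s1] by blast
    \<comment> \<open>The value at the root 1 of s is the only possible constant. Subtracting c
      times the unit from \<open>exists_unit_mod\<close> makes the rest vanish at 1, so its
      remainder modulo s is divisible by z - 1.\<close>
    define c where "c = poly p 1"
    define p' where "p' = p - Polynomial.smult c u"
    define r where "r = p' mod s"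
    have p': "p' = s * (p' div s) + r" by (simp add: r_def)
    have "poly p' 1 = 0" by (simp add: p'_def u(1) c_def)
    then have "poly r 1 = 0" using arg_cong[OF p', of "\<lambda>t. poly t 1"] s1 by simp
    then obtain t where t: "r = e1 * t" by (auto simp: poly_eq_0_iff_dvd e1_def elim: dvdE)
    have "poly.coeff t j = 0" if "j \<ge> d" for j
    proof (cases "t = 0")
      case False
      have "r \<noteq> 0" using False by (simp add: t e1)
      then have "degree r < Suc d"
        unfolding r_def deg[symmetric] using degree_mod_less[OF s_neq_0] by blast
      moreover have "degree r = Suc (degree t)" unfolding t using False by (subst degree_mult_eq) (auto simp: e1)
      ultimately show ?thesis using that by (simp add: coeff_eq_0)
    qed simp
    then have ph: "\<phi> t \<in> cvs.span B" unfolding span by blast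
    have pp: "p = Polynomial.smult c u + (s * (p' div s) + r)" by (simp add: p'[symmetric]) (simp add: p'_def)
    define v where "v = Z powi m * to_fract (Polynomial.smult c u + s * (p' div s))"
    have "v \<in> zpoly_space m 1" unfolding v_def mem_zpoly_space_1 by blast
    moreover have "v \<in> const_mod s"
    proof -
      have "v = const c * (Z powi m * to_fract u) + to_fract s * (Z powi m * to_fract (p' div s))"
        by (simp add: v_def to_fract_smult algebra_simps)
      also have "const c * (Z powi m * to_fract u) =
          const c + to_fract s * (Z powi 0 * to_fract (Polynomial.smult c l))"
        by (subst u(2)) (simp add: to_fract_smult algebra_simps)
      finally have v: "v = (const c + to_fract s * (Z powi 0 * to_fract (Polynomial.smult c l)))
          + (const 0 + to_fract s * (Z powi m * to_fract (p' div s)))" by simp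
      show ?thesis
        unfolding v
        by (rule cvs.subspace_add[OF subspace_const_mod]; rule mem_const_modI, rule refl)
    qed
    ultimately have "v \<in> const_mod_flag s n" unfolding flag by blast
    moreover have "x = \<phi> t + v"
    proof -
      have "x = Z powi m * to_fract (Polynomial.smult c u + (s * (p' div s) + r))"
        unfolding p by (subst pp) (rule refl)
      then show ?thesis by (simp add: v_def \<phi>_def t algebra_simps)
    qed
    ultimately show "x \<in> {u + v |u v. u \<in> cvs.span B \<and> v \<in> const_mod_flag s n}"
      using ph by blast
  qed
  moreover have "card B = d" by (simp add: B_def card_image[OF inj])
  moreover have "const_mod_flag s n \<subseteq> zpoly_space m 1" unfolding flag by blast
  ultimately show ?thesis
    unfolding has_codim_def m_def[symmetric] using fin indep triv by blast
qed

lemma rational_flag_const_mod_flag: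
  fixes s :: "complex poly"
  assumes s0: "poly s 0 = 1" and s1: "poly s 1 = 0"
  shows "rational_flag (const_mod_flag s)"
proof -
  define d where "d = degree s - 1"
  \<comment> \<open>The witness for r is z^d, whose inverse only shifts the level.\<close>
  have inv: "zpoly_space n (inverse (to_fract (Polynomial.monom 1 d))) = zpoly_space (n - int d) 1" for n
    by (simp add: zpoly_space_def to_fract_monom const_1 power_int_diff field_simps)
  have "zpoly_space n (to_fract s) \<subseteq> const_mod_flag s n" for n
  proof
    fix f assume "f \<in> zpoly_space n (to_fract s)"
    then obtain p where p: "f = Z powi n * to_fract s * to_fract p" by (auto simp: zpoly_space_def)
    have "f = const 0 + to_fract s * (Z powi n * to_fract p)" by (simp add: p)
    then have 1: "f \<in> const_mod s" by (rule mem_const_modI)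
    have "f = Z powi n * to_fract (s * p)" by (simp add: p)
    then have "f \<in> zpoly_space n 1" unfolding mem_zpoly_space_1 by blast
    then have "f \<in> zpoly_space (n - int (degree s - 1)) 1"
      using zpoly_space_mono[of "n - int (degree s - 1)" n] by auto
    with 1 show "f \<in> const_mod_flag s n" unfolding const_mod_flag_def by blast
  qed
  moreover have "const_mod_flag s n \<subseteq> zpoly_space (n - int d) 1" for n
    unfolding const_mod_flag_def d_def by blast
  ultimately have "\<forall>n. zpoly_space n (to_fract s) \<subseteq> const_mod_flag s n \<and>
      const_mod_flag s n \<subseteq> zpoly_space n (inverse (to_fract (Polynomial.monom 1 d))) \<and>
      has_codim (const_mod_flag s n) (zpoly_space n (inverse (to_fract (Polynomial.monom 1 d))))
        (degree (Polynomial.monom (1::complex) d))"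
    unfolding inv degree_monom_eq[OF one_neq_zero]
    using const_mod_flag_codim[OF s0 s1] unfolding d_def by blast
  moreover have "s \<noteq> 0" "Polynomial.monom (1::complex) d \<noteq> 0"
    using s0 by (auto simp: monom_eq_0_iff)
  ultimately show ?thesis
    unfolding rational_flag_def
    using subspace_const_mod_flag const_mod_flag_antimono_step by blast
qed

section \<open>The q-difference operators\<close>

context q_shift
begin

text \<open>Since Q^j z - Q^j a = Q^j (z - a), the dilation moves the pole from Q^j a to a. With a =
  mu_i and j = k_i this links the two points of a pair.\<close>

lemma dilate_pole:
  "dilate (Q ^ j) (Z powi n / (Z - const (Q ^ j * a))) =
    const ((Q powi n) ^ j / Q ^ j) * (Z powi n / (Z - const a))"
proof -
  have 1: "dilate (Q ^ j) (Z powi n) = const ((Q powi n) ^ j) * Z powi n"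
    using dilate_Z_powi[of "int j" n] by simp
  have "dilate (Q ^ j) (Z - const (Q ^ j * a)) = const (Q ^ j) * Z - const (Q ^ j * a)"
    by (simp add: dilate_diff dilate_Z)
  then have 2: "dilate (Q ^ j) (Z - const (Q ^ j * a)) = const (Q ^ j) * (Z - const a)"
    by (simp add: const_mult algebra_simps)
  have "dilate (Q ^ j) (x / y) = dilate (Q ^ j) x / dilate (Q ^ j) y" for x y
    by (simp add: divide_inverse dilate_mult dilate_inverse)
  then show ?thesis
    unfolding 1 2 const_divide by (simp add: 1 2)
qed

end

context double_points
begin

section \<open>Cramer's rule: from powers of z to the wave function\<close>

abbreviation Mu :: ratfun where "Mu \<equiv> \<Prod>i<g. Z - const (mu i)"

text \<open>The entry \<open>gluing n i j\<close> as a polynomial in x = Q^n. The factor mu_j^n is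
  not a polynomial in x, but it only rescales the j-th condition and is left out.\<close>

definition gluing_poly :: "nat \<Rightarrow> nat \<Rightarrow> complex poly" where
  "gluing_poly i j =
    Polynomial.smult (mu j ^ i) (Polynomial.monom (Q ^ (k j * i)) (k j) - [:\<delta> j:])"

lemma lam_powi: "j < g \<Longrightarrow> lam j powi n = (Q powi n) ^ k j * mu j powi n"
proof -
  have "(Q ^ k j) powi n = (Q powi n) ^ k j"
    by (metis power_int_mult power_int_of_nat mult.commute)
  then show "j < g \<Longrightarrow> lam j powi n = (Q powi n) ^ k j * mu j powi n"
    by (simp add: lam_eq power_int_mult_distrib)
qed

lemma gluing_conv_poly:
  assumes "j < g"
  shows "gluing n i j = mu j powi n * poly (gluing_poly i j) (Q powi n)"
proof -
  have "lam j ^ i = Q ^ (k j * i) * mu j ^ i"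
    by (simp add: lam_eq[OF assms] power_mult_distrib power_mult)
  then show ?thesis
    using assms by (simp add: gluing_eq gluing_poly_def poly_monom lam_powi algebra_simps)
qed

definition num_coeff :: "nat \<Rightarrow> complex poly" where
  "num_coeff i = border_cof g gluing_poly i"

abbreviation tau :: "complex poly" where "tau \<equiv> num_coeff g"

text \<open>At 0 the monomial in \<open>gluing_poly\<close> vanishes as k_j > 0; a Vandermonde
  matrix in the mu_j with columns scaled by -\<delta>_j remains.\<close>

lemma poly_tau_0: "poly tau 0 \<noteq> 0"
proof -
  have "poly tau 0 = det (mat g g (\<lambda>(i, j). - \<delta> j * mu j ^ i))"
    unfolding num_coeff_def border_cof_poly unfolding border_cof_last
    by (rule arg_cong[of _ _ det], rule eq_matI)
      (auto simp: gluing_poly_def poly_monom zero_power[OF k_pos])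
  then show ?thesis
    using det_scaled_vandermonde_neq_0[OF inj_mu, of "\<lambda>j. - \<delta> j"] delta_neq_0 by simp
qed

text \<open>Both sides satisfy the gluing conditions and have the same coefficient at z^g, so their
  difference has degree less than g and vanishes.\<close>

lemma tau_pw:
  "Polynomial.smult (poly tau (Q powi n)) (pw n) =
    (\<Sum>i\<le>g. Polynomial.monom (poly (num_coeff i) (Q powi n)) i)" (is "?l = ?r")
proof -
  have coeff: "poly.coeff ?r i = (if i \<le> g then poly (num_coeff i) (Q powi n) else 0)" for i
    by (simp add: coeff_sum)
  have "degree ?r \<le> g" by (rule degree_le) (simp add: coeff)
  moreover have "(\<Sum>i\<le>g. poly.coeff ?r i * gluing n i j) = 0" if j: "j < g" for j
  proof -
    have "(\<Sum>i\<le>g. poly.coeff ?r i * gluing n i j) =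
        mu j powi n * poly (\<Sum>i\<le>g. gluing_poly i j * num_coeff i) (Q powi n)"
      by (simp add: coeff gluing_conv_poly[OF j] poly_sum sum_distrib_left mult_ac)
    also have "\<dots> = 0" using border_cof_orthogonal[OF j, of gluing_poly] by (simp add: num_coeff_def)
    finally show ?thesis .
  qed
  ultimately have "glued n ?r" by (simp add: glued_iff)
  then have "glued n (?r - ?l)" by (intro glued_diff glued_smult glued_pw)
  moreover have "poly.coeff (?r - ?l) i = 0" if "i \<ge> g" for i
    using that coeff[of i] by (cases "i = g") (auto simp: coeff_pw[of n i])
  ultimately have "?r - ?l = 0" by (rule glued_low_degree_eq_0)
  then show ?thesis by simp
qed

text \<open>The dilation replaces x in the coefficients of \<open>tau_pw\<close> and stands to the
  right of the factors z^i / \<open>Lam\<close>, so that it acts on z^n first.\<close>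

definition S_op :: "ratfun \<Rightarrow> ratfun" where
  "S_op f = (\<Sum>i\<le>g. Z ^ i / Lam * poly_dil (num_coeff i) f)"

lemma S_op_in_ops: "S_op \<in> qop.ops"
proof -
  have "(\<lambda>f. \<Sum>i\<le>g. ((\<lambda>x. Z ^ i / Lam * x) \<circ> poly_dil (num_coeff i)) f) \<in> qop.ops"
    by (intro qop.sum_in_ops qop.comp_in_ops mult_in_ops poly_dil_in_ops)
  then show ?thesis by (simp add: S_op_def[abs_def] o_def)
qed

lemma S_op_Z_powi: "S_op (Z powi n) = const (poly tau (Q powi n)) * \<Psi> n"
proof -
  have "S_op (Z powi n) =
      Z powi n * to_fract (\<Sum>i\<le>g. Polynomial.monom (poly (num_coeff i) (Q powi n)) i) / Lam"
    by (simp add: S_op_def poly_dil_Z_powi to_fract_monom sum_distrib_left sum_divide_distrib mult_ac)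
  also have "\<dots> = const (poly tau (Q powi n)) * \<Psi> n"
    by (simp add: tau_pw[symmetric] wave_eq to_fract_smult)
  finally show ?thesis .
qed

section \<open>Elimination of poles: from the wave function back to powers of z\<close>

definition nodes :: "complex set" where
  "nodes = lam ` {..<g} \<union> mu ` {..<g}"

text \<open>At a node \<open>a\<close> this is the residue of 1 / (\<open>Lam\<close> *
  \<open>Mu\<close>).\<close>

definition weight :: "complex \<Rightarrow> complex" where
  "weight a = inverse (\<Prod>b\<in>nodes - {a}. a - b)"

lemma finite_nodes [simp]: "finite nodes"
  by (simp add: nodes_def)

lemma weight_neq_0: "weight a \<noteq> 0"
  by (simp add: weight_def)

lemma card_nodes: "card nodes = 2 * g"
  unfolding nodes_def using lam_mu_disjoint
  by (subst card_Un_disjoint) (auto simp: card_image inj_lam inj_mu)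

lemma prod_nodes: "(\<Prod>a\<in>nodes. Z - const a) = Lam * Mu"
  unfolding nodes_def using lam_mu_disjoint
  by (subst prod.union_disjoint) (auto simp: prod.reindex inj_lam inj_mu o_def)

lemma sum_nodes: "(\<Sum>a\<in>nodes. f a) = (\<Sum>j<g. f (lam j) + f (mu j))"
  unfolding nodes_def using lam_mu_disjoint
  by (subst sum.union_disjoint) (auto simp: sum.reindex inj_lam inj_mu o_def sum.distrib)

text \<open>The factor 1 / \<delta>_j comes from solving the gluing condition for the value at mu_j;
  the factor Q^(k_j) cancels the denominator produced by \<open>dilate_pole\<close>.\<close>

definition residue_poly :: "nat \<Rightarrow> nat \<Rightarrow> complex poly" where
  "residue_poly i j = [:weight (lam j) * lam j ^ i:] +
    Polynomial.monom (weight (mu j) * mu j ^ i * Q ^ k j / \<delta> j) (k j)"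

text \<open>Partial fractions. The gluing condition expresses the residue at \<open>\<mu>\<^sub>j\<close> through the one at
  \<open>\<lambda>\<^sub>j\<close>, up to the factor \<open>Q\<^bsup>n k\<^sub>j\<^esup>\<close>, which is absorbed by the \<open>k\<^sub>j\<close>-fold dilation moving the pole
  \<open>\<lambda>\<^sub>j\<close> to \<open>\<mu>\<^sub>j\<close>.\<close>

lemma wave_partial_fractions:
  assumes i: "i \<le> g"
  shows "Z ^ i / Mu * \<Psi> n = (if i = g then Z powi n else 0) +
    (\<Sum>j<g. const (poly (pw n) (lam j)) * poly_dil (residue_poly i j) (Z powi n / (Z - const (lam j))))"
proof -
  let ?H = "Polynomial.monom 1 i * pw n"
  have deg: "degree ?H \<le> card nodes"
    using i degree_pw[of n] pw_neq_0[of n] by (simp add: card_nodes degree_mult_eq degree_monom_eq monom_eq_0_iff)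
  \<comment> \<open>The numerator has degree i + g, which reaches the 2g of the denominator only for
    i = g. Thus the largest i alone contributes z^n itself.\<close>
  have top: "poly.coeff ?H (card nodes) = (if i = g then 1 else 0)"
  proof (cases "i = g")
    case False
    then have "2 * g - i > g" using i by simp
    then show ?thesis using False by (simp add: card_nodes coeff_shift_pw coeff_pw)
  qed (simp add: card_nodes coeff_shift_pw)
  let ?t = "\<lambda>a. const (weight a * poly ?H a) / (Z - const a)"
  have "Z ^ i / Mu * \<Psi> n = Z powi n * (to_fract ?H / (Lam * Mu))"
    by (simp add: wave_eq to_fract_monom const_1 mult_ac)
  also have "to_fract ?H / (Lam * Mu) = (if i = g then 1 else 0) + (\<Sum>a\<in>nodes. ?t a)"
    using partial_fractions[OF finite_nodes deg] unfolding prod_nodes top weight_def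
    by (simp add: const_1)
  also have "Z powi n * \<dots> = (if i = g then Z powi n else 0) +
      (\<Sum>j<g. Z powi n * (?t (lam j) + ?t (mu j)))"
    by (simp add: distrib_left sum_nodes sum_distrib_left)
  also have "(\<Sum>j<g. Z powi n * (?t (lam j) + ?t (mu j))) =
      (\<Sum>j<g. const (poly (pw n) (lam j)) * poly_dil (residue_poly i j) (Z powi n / (Z - const (lam j))))"
  proof (rule sum.cong[OF refl])
    fix j assume "j \<in> {..<g}"
    then have j: "j < g" by simp
    have mu: "poly (pw n) (mu j) = poly (pw n) (lam j) * ((Q powi n) ^ k j / \<delta> j)"
    proof -
      have "lam j powi n * poly (pw n) (lam j) = \<delta> j * (mu j powi n * poly (pw n) (mu j))"
        using glued_pw[of n] j by (simp add: glued_def)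
      from this[symmetric]
      have "mu j powi n * (\<delta> j * poly (pw n) (mu j)) = mu j powi n * ((Q powi n) ^ k j * poly (pw n) (lam j))"
        unfolding lam_powi[OF j] by (simp only: mult_ac)
      then have "\<delta> j * poly (pw n) (mu j) = (Q powi n) ^ k j * poly (pw n) (lam j)"
        using mu_neq_0[OF j] by (simp add: power_int_eq_0_iff)
      then show ?thesis using delta_neq_0[OF j] by (simp add: field_simps)
    qed
    have dil: "dilate (Q ^ k j) (Z powi n / (Z - const (lam j))) =
        const ((Q powi n) ^ k j / Q ^ k j) * (Z powi n / (Z - const (mu j)))"
      unfolding lam_eq[OF j] by (rule dilate_pole)
    have "poly_dil (residue_poly i j) (Z powi n / (Z - const (lam j))) =
        const (weight (lam j) * lam j ^ i) * (Z powi n / (Z - const (lam j))) +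
        const (weight (mu j) * mu j ^ i * Q ^ k j / \<delta> j * ((Q powi n) ^ k j / Q ^ k j)) *
          (Z powi n / (Z - const (mu j)))"
      unfolding residue_poly_def poly_dil_add poly_dil_pCons poly_dil_monom dil const_mult[of "_ / \<delta> j"]
      by (simp add: mult.assoc)
    also have "weight (mu j) * mu j ^ i * Q ^ k j / \<delta> j * ((Q powi n) ^ k j / Q ^ k j) =
        weight (mu j) * mu j ^ i * ((Q powi n) ^ k j / \<delta> j)"
      by (simp add: field_simps)
    finally have pd: "poly_dil (residue_poly i j) (Z powi n / (Z - const (lam j))) =
        const (weight (lam j) * lam j ^ i) * (Z powi n / (Z - const (lam j))) +
        const (weight (mu j) * mu j ^ i * ((Q powi n) ^ k j / \<delta> j)) * (Z powi n / (Z - const (mu j)))" .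
    have hl: "weight (lam j) * poly ?H (lam j) = poly (pw n) (lam j) * (weight (lam j) * lam j ^ i)"
      and hm: "weight (mu j) * poly ?H (mu j) =
        poly (pw n) (lam j) * (weight (mu j) * mu j ^ i * ((Q powi n) ^ k j / \<delta> j))"
      by (simp_all add: poly_monom mu)
    have alg: "w * (p * A / x + p * B / y) = p * (A * (w / x) + B * (w / y))"
      for w p A B x y :: ratfun
      by (simp add: distrib_left mult_ac)
    show "Z powi n * (?t (lam j) + ?t (mu j)) =
        const (poly (pw n) (lam j)) * poly_dil (residue_poly i j) (Z powi n / (Z - const (lam j)))"
      unfolding hl hm pd const_mult[of "poly (pw n) (lam j)"] by (rule alg)
  qed
  finally show ?thesis .
qed

definition elim_coeff :: "nat \<Rightarrow> complex poly" where
  "elim_coeff i = border_cof g residue_poly i"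

abbreviation theta :: "complex poly" where "theta \<equiv> elim_coeff g"

text \<open>At 0 the contribution of the mu_j disappears because k_j > 0, leaving a Vandermonde
  matrix in the lam_j with columns scaled by nonzero residues.\<close>

lemma poly_theta_0: "poly theta 0 \<noteq> 0"
proof -
  have "poly theta 0 = det (mat g g (\<lambda>(i, j). weight (lam j) * lam j ^ i))"
    unfolding elim_coeff_def border_cof_poly unfolding border_cof_last
    by (rule arg_cong[of _ _ det], rule eq_matI)
      (auto simp: residue_poly_def poly_monom zero_power[OF k_pos])
  then show ?thesis
    using det_scaled_vandermonde_neq_0[OF inj_lam, of "\<lambda>j. weight (lam j)"] weight_neq_0 by simp
qed

text \<open>In contrast to \<open>S_op\<close>, the polynomials in the dilation stand on the left,
  since they have to combine the partial fractions of the z^i \<open>\<Psi> n\<close> /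
  \<open>Mu\<close>.\<close>

definition R_op :: "ratfun \<Rightarrow> ratfun" where
  "R_op f = (\<Sum>i\<le>g. poly_dil (elim_coeff i) (Z ^ i / Mu * f))"

lemma R_op_in_ops: "R_op \<in> qop.ops"
proof -
  have "(\<lambda>f. \<Sum>i\<le>g. (poly_dil (elim_coeff i) \<circ> (\<lambda>x. Z ^ i / Mu * x)) f) \<in> qop.ops"
    by (intro qop.sum_in_ops qop.comp_in_ops mult_in_ops poly_dil_in_ops)
  then show ?thesis by (simp add: R_op_def[abs_def] o_def)
qed

text \<open>The values of \<open>pw n\<close> at the lam_j depend on n but not on z, so they pass
  through the operators. By orthogonality of the cofactors, the total operator applied to each z^n /
  (z - lam_j) is zero; only theta of the dilation on z^n survives.\<close>

lemma R_op_wave: "R_op (\<Psi> n) = const (poly theta (Q powi n)) * Z powi n"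
proof -
  let ?u = "\<lambda>j. Z powi n / (Z - const (lam j))" and ?p = "\<lambda>j. const (poly (pw n) (lam j))"
  have "poly_dil (elim_coeff i) (Z ^ i / Mu * \<Psi> n) =
      (if i = g then poly_dil theta (Z powi n) else 0) +
      (\<Sum>j<g. ?p j * poly_dil (residue_poly i j * elim_coeff i) (?u j))" if "i \<le> g" for i
    unfolding wave_partial_fractions[OF that]
    by (simp add: qop.ops_add[OF poly_dil_in_ops] qop.ops_sum[OF poly_dil_in_ops]
        qop_const_mult[OF poly_dil_in_ops] qop.ops_0[OF poly_dil_in_ops]
        mult.commute[of "residue_poly _ _"] poly_dil_mult)
  then have "R_op (\<Psi> n) = (\<Sum>i\<le>g. (if i = g then poly_dil theta (Z powi n) else 0) +
      (\<Sum>j<g. ?p j * poly_dil (residue_poly i j * elim_coeff i) (?u j)))"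
    unfolding R_op_def by (intro sum.cong) auto
  also have "\<dots> = poly_dil theta (Z powi n) +
      (\<Sum>j<g. ?p j * poly_dil (\<Sum>i\<le>g. residue_poly i j * elim_coeff i) (?u j))"
    by (subst sum.distrib, subst sum.swap) (simp add: poly_dil_sum sum_distrib_left)
  also have "\<dots> = poly_dil theta (Z powi n)"
    by (simp add: elim_coeff_def border_cof_orthogonal)
  finally show ?thesis by (simp add: poly_dil_Z_powi)
qed

section \<open>Uniqueness and the ring of q-difference operators\<close>

lemma S_op_has_order: "\<exists>d. qop.has_order S_op d"
proof -
  have "tau \<noteq> 0" using poly_tau_0 by auto
  then obtain n where "poly tau (Q powi n) \<noteq> 0" using poly_eq_0_if_Q_powi by blast
  then have "S_op (Z powi n) \<noteq> 0" by (simp add: S_op_Z_powi wave_neq_0)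
  then show ?thesis by (rule qop.exists_has_order[OF S_op_in_ops])
qed

text \<open>Orders add under composition, so if \<open>P\<close> were nonzero then
  \<open>P \<circ> S_op\<close> would have an order and could not annihilate all powers of
  z.\<close>

lemma qop_eq_0_if_kills_wave:
  assumes P: "P \<in> qop.ops" and kill: "\<And>n. P (\<Psi> n) = 0"
  shows "P f = 0"
proof (rule ccontr)
  assume "P f \<noteq> 0"
  then obtain a where a: "qop.has_order P a" using qop.exists_has_order[OF P] by blast
  obtain b where b: "qop.has_order S_op b" using S_op_has_order by blast
  obtain n where "(P \<circ> S_op) (Z powi n) \<noteq> 0"
    using has_order_not_kills_powers[OF qop_has_order_comp[OF a b]] by blast
  then show False by (simp add: S_op_Z_powi qop_const_mult[OF P] kill)
qed

text \<open>The operator \<open>S_op \<circ> \<gamma>(dilate Q - 1) \<circ> R_op\<close> has the eigenvalue \<open>conductor(Q\<^sup>n)\<close> on \<open>\<Psi> n\<close>.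
  The factor \<open>dilate Q - 1\<close> provides the root 1 that \<open>const_mod_flag_codim\<close> needs, and \<open>\<gamma>\<close>
  normalizes the value at 0 to 1.\<close>

definition gam_poly :: "complex poly" where
  "gam_poly = Polynomial.smult (- inverse (poly theta 0 * poly tau 0)) [:- 1, 1:]"

definition conductor :: "complex poly" where
  "conductor = gam_poly * theta * tau"

lemma poly_conductor_0: "poly conductor 0 = 1" and poly_conductor_1: "poly conductor 1 = 0"
  using poly_tau_0 poly_theta_0 by (simp_all add: conductor_def gam_poly_def field_simps)

text \<open>The eigenvalue is the general element of \<open>const_mod conductor\<close> at Q^n. The
  power e may be negative, so it is carried by a separate dilation rather than by
  \<open>poly_dil\<close>.\<close>

definition B_op :: "complex \<Rightarrow> int \<Rightarrow> complex poly \<Rightarrow> ratfun \<Rightarrow> ratfun" where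
  "B_op c e l f = const c * f + (S_op \<circ> dilate (Q powi e) \<circ> (poly_dil (l * gam_poly) \<circ> R_op)) f"

lemma B_op_in_ops: "B_op c e l \<in> qop.ops"
proof -
  have "(\<lambda>f. const c * f + (S_op \<circ> dilate (Q powi e) \<circ> (poly_dil (l * gam_poly) \<circ> R_op)) f) \<in> qop.ops"
    by (intro qop.add_in_ops mult_in_ops qop.comp_in_ops S_op_in_ops R_op_in_ops qop.sig_in_ops
        poly_dil_in_ops)
  then show ?thesis by (simp add: B_op_def[abs_def])
qed

lemma B_op_wave:
  "B_op c e l (\<Psi> n) =
    const (c + poly conductor (Q powi n) * ((Q powi n) powi e * poly l (Q powi n))) * \<Psi> n"
proof -
  let ?x = "Q powi n"
  have 1: "(poly_dil (l * gam_poly) \<circ> R_op) (\<Psi> n) =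
      const (poly theta ?x * (poly l ?x * poly gam_poly ?x)) * Z powi n"
    by (simp only: o_apply R_op_wave qop_const_mult[OF poly_dil_in_ops] poly_dil_Z_powi const_mult
        poly_mult mult.assoc)
  have 2: "dilate (Q powi e) (const a * Z powi n) = const (a * ?x powi e) * Z powi n" for a
    by (simp only: qop_const_mult[OF qop.sig_in_ops] dilate_Z_powi const_mult mult.assoc)
  have 3: "S_op (const a * Z powi n) = const (a * poly tau ?x) * \<Psi> n" for a
    by (simp only: qop_const_mult[OF S_op_in_ops] S_op_Z_powi const_mult mult.assoc)
  have "B_op c e l (\<Psi> n) = const c * \<Psi> n +
      const (poly theta ?x * (poly l ?x * poly gam_poly ?x) * ?x powi e * poly tau ?x) * \<Psi> n"
    unfolding B_op_def o_apply[of _ "poly_dil (l * gam_poly) \<circ> R_op"] 1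
    by (simp only: o_apply 2 3)
  also have "\<dots> = const (c + poly theta ?x * (poly l ?x * poly gam_poly ?x) * ?x powi e * poly tau ?x) * \<Psi> n"
    by (simp only: const_add distrib_right)
  also have "poly theta ?x * (poly l ?x * poly gam_poly ?x) * ?x powi e * poly tau ?x =
      poly conductor ?x * (?x powi e * poly l ?x)"
    by (simp add: conductor_def)
  finally show ?thesis .
qed

lemma exists_B_op_order_1: "\<exists>e. qop.has_order (B_op 0 e 1) 1"
proof -
  obtain a where a: "qop.has_order S_op a" using S_op_has_order by blast
  have "gam_poly * theta \<noteq> 0"
    using poly_conductor_0 by (metis conductor_def mult_zero_left poly_0 zero_neq_one)
  then obtain n where "poly (gam_poly * theta) (Q powi n) \<noteq> 0" using poly_eq_0_if_Q_powi by blast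
  then have "(poly_dil (1 * gam_poly) \<circ> R_op) (\<Psi> n) \<noteq> 0"
    by (simp add: R_op_wave qop_const_mult[OF poly_dil_in_ops] poly_dil_Z_powi power_int_eq_0_iff)
  then obtain b where b: "qop.has_order (poly_dil (1 * gam_poly) \<circ> R_op) b"
    using qop.exists_has_order qop.comp_in_ops poly_dil_in_ops R_op_in_ops by meson
  \<comment> \<open>The free dilation in the middle shifts the total order a + e + b to 1, whatever
    the orders of the outer factors are.\<close>
  define e where "e = 1 - a - b"
  have "dilate (Q powi e) = qop.op (\<lambda>j. if j = e then 1 else 0)"
    using qop.monomial_eq_op[of 1 e] by (simp add: fun_eq_iff)
  then have "qop.has_order (dilate (Q powi e)) e"
    unfolding qop.has_order_def by (intro exI[of _ "\<lambda>j. if j = e then 1 else 0"]) auto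
  then have "qop.has_order (S_op \<circ> dilate (Q powi e) \<circ> (poly_dil (1 * gam_poly) \<circ> R_op)) (a + e + b)"
    by (intro qop_has_order_comp a b)
  moreover have "B_op 0 e 1 = S_op \<circ> dilate (Q powi e) \<circ> (poly_dil (1 * gam_poly) \<circ> R_op)"
    by (simp add: fun_eq_iff B_op_def)
  ultimately have "qop.has_order (B_op 0 e 1) (a + e + b)" by metis
  then show ?thesis by (intro exI[of _ e]) (simp add: e_def)
qed

lemma q_difference_side:
  "\<exists>W. rational_flag W \<and>
     (\<exists>B. B ` flag_ring W \<subseteq> qdiff_ops q
        \<and> cring (op_ring (B ` flag_ring W))
        \<and> B \<in> ring_iso (func_ring (flag_ring W)) (op_ring (B ` flag_ring W))
        \<and> qdiff_rank q (B ` flag_ring W) = 1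
        \<and> (\<forall>h\<in>flag_ring W. \<forall>n.
              B h (\<Psi> n) = const (rf_eval h (Q powi n)) * \<Psi> n))"
proof -
  define A where "A = flag_ring (const_mod_flag conductor)"
  \<comment> \<open>The absence of poles is part of the relation because \<open>rf_eval_add\<close>
    and \<open>rf_eval_mult\<close> require it.\<close>
  define rep where "rep f P \<longleftrightarrow> P \<in> qop.ops \<and> (\<forall>a. a \<noteq> 0 \<longrightarrow> \<not> pole_at f a) \<and>
    (\<forall>n. P (\<Psi> n) = const (rf_eval f (Q powi n)) * \<Psi> n)" for f P
  have closed:
    "0 \<in> A" "1 \<in> A"
    "\<And>f g. f \<in> A \<Longrightarrow> g \<in> A \<Longrightarrow> f + g \<in> A"
    "\<And>f g. f \<in> A \<Longrightarrow> g \<in> A \<Longrightarrow> f * g \<in> A"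
    "\<And>f. f \<in> A \<Longrightarrow> - f \<in> A"
    unfolding A_def
    by (rule flag_ring_closed[of "const_mod_flag conductor", OF subspace_const_mod_flag
          const_mod_flag_antimono_step]; assumption)+
  have rep_B: "rep (const c + to_fract conductor * (Z powi e * to_fract l)) (B_op c e l)" for c e l
  proof -
    have *: "to_fract conductor * (Z powi e * to_fract l) = Z powi e * to_fract (conductor * l)"
      by simp
    have "rf_eval (const c + Z powi e * to_fract (conductor * l)) a =
        c + poly conductor a * (a powi e * poly l a)" if "a \<noteq> 0" for a
      using that
      by (simp add: rf_eval_add rf_eval_const not_pole_laurent rf_eval_laurent mult.left_commute
          del: to_fract_mult)
    moreover have "\<not> pole_at (const c + Z powi e * to_fract (conductor * l)) a" if "a \<noteq> 0" for a
      using that by (intro rf_eval_add rf_eval_const not_pole_laurent)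
    ultimately show ?thesis
      unfolding rep_def * using B_op_in_ops by (simp add: B_op_wave del: to_fract_mult)
  qed
  have ex: "\<exists>P. rep f P" if "f \<in> A" for f
  proof -
    obtain c e l where "f = const c + to_fract conductor * (Z powi e * to_fract l)"
      using \<open>f \<in> A\<close> flag_ring_subset_const_mod[of conductor] unfolding A_def const_mod_def by blast
    then show ?thesis using rep_B by blast
  qed
  have rep_0: "rep 0 (\<lambda>x. 0)"
    using qop.zero_in_ops rf_eval_const[of 0] by (simp add: rep_def)
  have rep_1: "rep 1 id"
    using qop.id_in_ops rf_eval_const[of 1] by (simp add: rep_def const_1)
  have rep_add: "rep (f + h) (\<lambda>x. P x + R x)" if "rep f P" "rep h R" for f h P R
    using that qop.add_in_ops[of P R]
    by (simp add: rep_def rf_eval_add const_add distrib_right)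
  have rep_mult: "rep (f * h) (P \<circ> R)" if fP: "rep f P" and hR: "rep h R" for f h P R
  proof -
    have PR: "P \<in> qop.ops" "P \<circ> R \<in> qop.ops"
      using fP hR qop.comp_in_ops unfolding rep_def by blast+
    have "(P \<circ> R) (\<Psi> n) = const (rf_eval f (Q powi n) * rf_eval h (Q powi n)) * \<Psi> n" for n
    proof -
      have "R (\<Psi> n) = const (rf_eval h (Q powi n)) * \<Psi> n"
        "P (\<Psi> n) = const (rf_eval f (Q powi n)) * \<Psi> n"
        using fP hR unfolding rep_def by blast+
      then show ?thesis
        by (simp only: o_apply qop_const_mult[OF PR(1)]) (simp add: const_mult)
    qed
    then show ?thesis
      using fP hR PR(2) by (simp add: rep_def rf_eval_mult)
  qed
  have rep_unique: "P = R" if P: "rep f P" and R: "rep f R" for f P R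
  proof
    fix x
    let ?D = "\<lambda>x. P x + ((\<lambda>y. const (- 1) * y) \<circ> R) x"
    have "?D \<in> qop.ops"
      using P R unfolding rep_def by (intro qop.add_in_ops qop.comp_in_ops mult_in_ops) auto
    moreover have "?D (\<Psi> n) = 0" for n
      using P R by (simp add: rep_def const_minus const_1)
    ultimately have "?D x = 0" by (rule qop_eq_0_if_kills_wave)
    then show "P x = R x" by (simp add: const_minus const_1)
  qed
  have rep_inj: "f = h" if "f \<in> A" "h \<in> A" and P: "rep f P" "rep h P" for f h P
  proof -
    have eq: "rf_eval f (Q powi n) = rf_eval h (Q powi n)" for n
      using P wave_neq_0[of n] by (auto simp: rep_def)
    have pole: "\<forall>a. a \<noteq> 0 \<longrightarrow> \<not> pole_at f a" "\<forall>a. a \<noteq> 0 \<longrightarrow> \<not> pole_at h a"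
      using P by (auto simp: rep_def)
    obtain e p where p: "f = Z powi e * to_fract p" using pole(1) unfolding laurent_iff by blast
    obtain e' p' where p': "h = Z powi e' * to_fract p'" using pole(2) unfolding laurent_iff by blast
    \<comment> \<open>The difference of the two eigenvalues is again a Laurent polynomial, and it
      vanishes at all Q^n.\<close>
    obtain d r where r: "Z powi e * to_fract p + Z powi e' * to_fract (- p') = Z powi d * to_fract r"
      using laurent_add by blast
    have "poly r (Q powi n) = 0" for n
    proof -
      let ?x = "Q powi n"
      have "?x powi d * poly r ?x = rf_eval (Z powi e * to_fract p + Z powi e' * to_fract (- p')) ?x"
        unfolding r by (simp add: rf_eval_laurent)
      also have "\<dots> = rf_eval f ?x - rf_eval h ?x"
        by (simp add: rf_eval_add not_pole_laurent rf_eval_laurent p p' del: to_fract_uminus)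
      finally show ?thesis using eq[of n] by (simp add: power_int_eq_0_iff)
    qed
    then have "r = 0" by (rule poly_eq_0_if_Q_powi)
    then show ?thesis using r p p' by simp
  qed
  obtain B where B: "\<And>f. f \<in> A \<Longrightarrow> rep f (B f)" "cring (op_ring (B ` A))"
      "B \<in> ring_iso (func_ring A) (op_ring (B ` A))"
    by (rule operator_ring_iso[of A rep])
      (assumption | rule closed ex rep_0 rep_1 rep_add rep_mult rep_unique rep_inj | blast)+
  obtain e where e: "qop.has_order (B_op 0 e 1) 1" using exists_B_op_order_1 by blast
  \<comment> \<open>This is the case c = 0, l = 1 of \<open>rep_B\<close>; uniqueness identifies the
    chosen operator with \<open>B_op 0 e 1\<close>, of order 1.\<close>
  have f: "Z powi e * to_fract conductor \<in> A" unfolding A_def by (rule Z_powi_s_in_flag_ring)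
  have "rep (Z powi e * to_fract conductor) (B_op 0 e 1)"
    using rep_B[of 0 e 1] by (simp add: mult.commute)
  then have "B (Z powi e * to_fract conductor) = B_op 0 e 1" using B(1)[OF f] rep_unique by blast
  then have "(1::int) \<in> {d. \<exists>P\<in>B ` A. qdiff_has_order q P d}"
    using f e unfolding qop_has_order_eq by (metis (mono_tags, lifting) image_eqI mem_Collect_eq)
  then have "qdiff_rank q (B ` A) = 1"
    unfolding qdiff_rank_def by (intro Gcd_eq_1_I[of 1]) simp_all
  moreover have "rational_flag (const_mod_flag conductor)"
    by (rule rational_flag_const_mod_flag[OF poly_conductor_0 poly_conductor_1])
  ultimately show ?thesis
    using B unfolding A_def rep_def qop_ops_eq
    by (intro exI[of _ "const_mod_flag conductor"] conjI exI[of _ B]) auto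
qed

end

theorem proposition8p8:
  fixes q :: real and g :: nat
    and lam mu \<delta> :: "nat \<Rightarrow> complex" and k :: "nat \<Rightarrow> nat"
  assumes q: "0 < q" "q < 1"
    and nonzero: "\<And>i. i < g \<Longrightarrow> lam i \<noteq> 0" "\<And>i. i < g \<Longrightarrow> mu i \<noteq> 0"
    and distinct_points: "inj_on lam {..<g}" "inj_on mu {..<g}"
      "lam ` {..<g} \<inter> mu ` {..<g} = {}"
    and k_pos: "\<And>i. i < g \<Longrightarrow> k i > 0"
    and lam_mu: "\<And>i. i < g \<Longrightarrow> lam i = complex_of_real q ^ k i * mu i"
    and delta_nonzero: "\<And>i. i < g \<Longrightarrow> \<delta> i \<noteq> 0"
    and den_nonzero: "\<And>n. wave_den g lam mu \<delta> n \<noteq> 0"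
  defines "V \<equiv> curve_flag g lam mu \<delta>"
    and "\<Psi> \<equiv> wave g lam mu \<delta>"
  shows
    "(\<exists>L. L ` flag_ring V \<subseteq> diff_ops
        \<and> cring (op_ring (L ` flag_ring V))
        \<and> L \<in> ring_iso (func_ring (flag_ring V)) (op_ring (L ` flag_ring V))
        \<and> diff_rank (L ` flag_ring V) = 1
        \<and> (\<forall>f\<in>flag_ring V. L f \<Psi> = (\<lambda>n. f * \<Psi> n)))
     \<and>
     (\<exists>W. rational_flag W \<and>
       (\<exists>B. B ` flag_ring W \<subseteq> qdiff_ops q
          \<and> cring (op_ring (B ` flag_ring W))
          \<and> B \<in> ring_iso (func_ring (flag_ring W)) (op_ring (B ` flag_ring W))
          \<and> qdiff_rank q (B ` flag_ring W) = 1
          \<and> (\<forall>h\<in>flag_ring W. \<forall>n.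
                B h (\<Psi> n) = const (rf_eval h (complex_of_real q powi n)) * \<Psi> n)))"
proof -
  interpret double_points q g lam mu \<delta> k
    by unfold_locales (use assms(1-11) in auto)
  show ?thesis
    unfolding V_def \<Psi>_def using difference_side q_difference_side by blast
qed

end
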